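(* Let $N\ge2$ be an integer and $\alpha<-1$. For any real $Q$ with $2\le Q\le\frac{2N}{N-2}$ in case $N\ge3$, or $Q\ge2$ in case $N=2$, there exists a positive constant $C=C(N,\alpha,Q)$ such that for every $f\in C_0^\infty(\mathcal C_1)$ $$\left(\int_{\mathcal C_1}(1-|\lambda|)^{\alpha}|f(x',\lambda)|^Q\,dx'\,d\lambda\right)^{\frac2Q}\le C\int_{\mathcal C_1}(1-|\lambda|)^\alpha\left(|\nabla_{x'}f|^2+(1-|\lambda|)^2|\partial_\lambda f|^2\right)dx'\,d\lambda.$$
   Context: Points of $\mathbb R^N$ are written $(x',\lambda)\in\mathbb R^{N-1}\times\mathbb R$, and $\mathcal C_1:=\{(x',\lambda)\in\mathbb R^{N-1}\times\mathbb R:|x'|<1,\ |\lambda|<1\}$. $C_0^\infty(U)$ denotes the smooth real-valued functions with compact support in the open set $U$. $\nabla_{x'}$ is the gradient in the $x'$ variables. *)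

theory Defs
  imports "HOL-Analysis.Analysis"
begin

text \<open>Points of $\mathbb{R}^N$ are pairs \<open>(x, l)\<close> of type \<open>(real ^ 'n) \<times> real\<close> with
  \<open>CARD('n) = N - 1\<close>; the norm of the product type is the Euclidean one.\<close>

definition cyl1 :: "((real ^ 'n) \<times> real) set" where
  "cyl1 = {(x, l). norm x < 1 \<and> \<bar>l\<bar> < 1}"

text \<open>\<open>C_k k f\<close> says that \<open>f\<close> is differentiable \<open>k\<close> times and that all iterated directional
  derivatives of order at most \<open>k\<close> are continuous. A differentiable function is continuous, so
  continuity of the lower order derivatives need not be required separately.\<close>

primrec C_k :: "nat \<Rightarrow> ('a::euclidean_space \<Rightarrow> real) \<Rightarrow> bool" where
  "C_k 0 f \<longleftrightarrow> continuous_on UNIV f"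
| "C_k (Suc k) f \<longleftrightarrow>
     (\<forall>z. f differentiable (at z)) \<and> (\<forall>v. C_k k (\<lambda>z. frechet_derivative f (at z) v))"

definition smooth :: "('a::euclidean_space \<Rightarrow> real) \<Rightarrow> bool" where
  "smooth f \<longleftrightarrow> (\<forall>k. C_k k f)"

text \<open>Functions with compact support in \<open>U\<close> are identified with their extension by zero to the
  whole space.\<close>

definition C0_infinity :: "'a::euclidean_space set \<Rightarrow> ('a \<Rightarrow> real) set" where
  "C0_infinity U = {f. smooth f \<and> compact (closure (support_on UNIV f))
                       \<and> closure (support_on UNIV f) \<subseteq> U}"

definition grad_x :: "((real ^ 'n) \<times> real \<Rightarrow> real) \<Rightarrow> (real ^ 'n) \<times> real \<Rightarrow> real ^ 'n" where
  "grad_x f = (\<lambda>(x, l). THE D. GDERIV (\<lambda>y. f (y, l)) x :> D)"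

definition partial_l :: "((real ^ 'n) \<times> real \<Rightarrow> real) \<Rightarrow> (real ^ 'n) \<times> real \<Rightarrow> real" where
  "partial_l f = (\<lambda>(x, l). deriv (\<lambda>s. f (x, s)) l)"

end

theory Submission
  imports Defs
begin

text \<open>Write \<open>\<rho> = 1 - \<bar>\<lambda>\<bar>\<close>, \<open>G\<^sup>2 = \<bar>\<nabla>\<^sub>x f\<bar>\<^sup>2 + \<rho>\<^sup>2 \<bar>\<partial>\<^sub>\<lambda> f\<bar>\<^sup>2\<close>, \<open>m p = \<integral> \<rho> powr \<alpha> * \<bar>f\<bar> powr p\<close>,
  \<open>K = \<integral> \<rho> powr \<alpha> * G\<^sup>2\<close> and \<open>n = N - 1\<close>. In the coordinate \<open>t = - ln \<rho>\<close> the operator \<open>\<rho> \<partial>\<^sub>\<lambda>\<close> becomes \<open>\<partial>\<^sub>t\<close>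
  up to sign and \<open>d\<lambda>\<close> becomes \<open>\<rho> dt\<close>, so the claim is a Sobolev inequality on a cylinder with a weight that
  grows exponentially towards both ends. The proof is Gagliardo's, carried out directly with the weight.

  Fix \<open>s > 1\<close> and put \<open>H = \<rho> powr \<alpha> * s * \<bar>f\<bar> powr (s - 1) * G\<close>. Along a line parallel to the \<open>x\<close> variables
  the weight is constant, and the fundamental theorem of calculus bounds \<open>\<rho> powr \<alpha> * \<bar>f\<bar> powr s\<close> by the
  integral of \<open>H\<close> over that line (\<open>horizontal_bound\<close>). Along the \<open>\<lambda>\<close> direction one integrates from the
  given point outwards, away from \<open>\<lambda> = 0\<close>: there \<open>\<rho>\<close> decreases, so \<open>\<rho> powr (\<alpha> + 1)\<close>, whose exponent is
  negative, increases, and \<open>\<rho> powr (\<alpha> + 1) * \<bar>f\<bar> powr s\<close> at the point is bounded by the integral of \<open>H\<close>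
  with no contribution from the derivative of the weight (\<open>vertical_bound\<close>). The product of the \<open>N\<close> line
  integrals, each to the power \<open>1/n\<close>, therefore dominates \<open>\<rho> powr \<alpha> * \<bar>f\<bar> powr (s N / n)\<close>, and
  Gagliardo's inequality (\<open>gagliardo_lborel\<close>) followed by Cauchy--Schwarz (\<open>integral_power_gradient_le\<close>) gives
  the recursion \<open>weighted_sobolev_step\<close>: \<open>m (s N / n) \<le> (s * sqrt (m (2 (s - 1)) * K)) powr (N / n)\<close>.

  If \<open>N \<ge> 3\<close>, the choice \<open>s = 2n / (N - 2)\<close> makes both exponents equal to the critical one,
  \<open>P = 2N / (N - 2)\<close>, and \<open>m P\<close> is absorbed because it occurs on the right with a power below one
  (\<open>weighted_sobolev_critical\<close>). If \<open>N = 2\<close>, the recursion bounds \<open>m (2s)\<close> by \<open>s\<^sup>2 * m (2s - 2) * K\<close>, so an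
  induction starting at \<open>m 2\<close> reaches every even exponent (\<open>weighted_sobolev_even_exponent\<close>). The bound
  \<open>m 2 \<le> 16 K\<close> is the Poincare inequality in one \<open>x\<close> direction (\<open>weighted_poincare\<close>). Any \<open>Q\<close> between
  \<open>2\<close> and such a \<open>P\<close> follows because \<open>t powr Q \<le> t\<^sup>2 + t powr P\<close> (\<open>weighted_mass_interpolation\<close>).\<close>

section \<open>Hoelder's inequality for finitely many functions\<close>

text \<open>Weighted inequality of arithmetic and geometric means, which is Jensen's inequality for \<open>exp\<close> at the
  points \<open>ln (x i)\<close>. It also holds when some \<open>x i\<close> and \<open>p i\<close> vanish together: the convention
  \<open>0 powr 0 = 0\<close> only makes the left-hand side smaller.\<close>

lemma prod_powr_le_weighted_mean:
  fixes x p :: "'i \<Rightarrow> real"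
  assumes "finite J" "\<And>i. i \<in> J \<Longrightarrow> 0 \<le> x i" "\<And>i. i \<in> J \<Longrightarrow> 0 \<le> p i" "(\<Sum>i\<in>J. p i) = 1"
  shows "(\<Prod>i\<in>J. x i powr p i) \<le> (\<Sum>i\<in>J. p i * x i)"
proof (cases "\<exists>i\<in>J. x i = 0")
  case True
  then have "(\<Prod>i\<in>J. x i powr p i) = 0"
    using assms(1) by (auto intro: prod_zero)
  moreover have "0 \<le> (\<Sum>i\<in>J. p i * x i)"
    using assms(2,3) by (intro sum_nonneg mult_nonneg_nonneg) auto
  ultimately show ?thesis by simp
next
  case False
  then have pos: "0 < x i" if "i \<in> J" for i
    using assms(2) that by (metis less_eq_real_def)
  have "J \<noteq> {}" using assms(4) by auto
  have "exp (\<Sum>i\<in>J. p i *\<^sub>R ln (x i)) \<le> (\<Sum>i\<in>J. p i * exp (ln (x i)))"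
    by (rule convex_on_sum[OF assms(1) \<open>J \<noteq> {}\<close> exp_convex assms(4)]) (use assms in auto)
  moreover have "(\<Prod>i\<in>J. x i powr p i) = exp (\<Sum>i\<in>J. p i *\<^sub>R ln (x i))"
    using pos[THEN less_imp_neq] by (simp add: exp_sum assms(1) powr_def)
  ultimately show ?thesis using pos by simp
qed

text \<open>After normalising every \<open>g i\<close> to integral one, the integrand is at most \<open>\<Sum>i\<in>J. p i * g i\<close>, whose
  integral is one. If some \<open>g i\<close> has integral zero it vanishes almost everywhere, and with it the product.\<close>

lemma Holder_integral_prod:
  fixes g :: "'i \<Rightarrow> 'a \<Rightarrow> real"
  assumes J: "finite J" and p: "\<And>i. i \<in> J \<Longrightarrow> 0 \<le> p i" "(\<Sum>i\<in>J. p i) = 1"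
    and g: "\<And>i. i \<in> J \<Longrightarrow> integrable M (g i)"
    and nn: "\<And>i x. i \<in> J \<Longrightarrow> x \<in> space M \<Longrightarrow> 0 \<le> g i x"
  shows "(\<integral>x. (\<Prod>i\<in>J. g i x powr p i) \<partial>M) \<le> (\<Prod>i\<in>J. (\<integral>x. g i x \<partial>M) powr p i)"
proof (cases "\<exists>i\<in>J. (\<integral>x. g i x \<partial>M) = 0")
  case True
  then obtain i where i: "i \<in> J" "(\<integral>x. g i x \<partial>M) = 0" by auto
  have "AE x in M. g i x = 0"
    using integral_nonneg_eq_0_iff_AE[OF g[OF i(1)]] i nn by auto
  then have "AE x in M. (\<Prod>i\<in>J. g i x powr p i) = 0"
    by eventually_elim (intro prod_zero J bexI[OF _ i(1)], simp)
  then have "(\<integral>x. (\<Prod>i\<in>J. g i x powr p i) \<partial>M) = 0"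
    by (rule integral_eq_zero_AE)
  then show ?thesis by (simp add: prod_nonneg)
next
  case False
  define c where "c i = (\<integral>x. g i x \<partial>M)" for i
  have c: "0 < c i" if "i \<in> J" for i
  proof -
    have "0 \<le> c i"
      unfolding c_def by (intro Bochner_Integration.integral_nonneg nn that)
    with False that show ?thesis by (auto simp: c_def)
  qed
  have "(\<integral>x. (\<Prod>i\<in>J. g i x powr p i) \<partial>M) \<le> (\<integral>x. (\<Prod>i\<in>J. c i powr p i) * (\<Sum>i\<in>J. p i * (g i x / c i)) \<partial>M)"
  proof (rule integral_mono')
    show "integrable M (\<lambda>x. (\<Prod>i\<in>J. c i powr p i) * (\<Sum>i\<in>J. p i * (g i x / c i)))"
      using g by auto
  next
    fix x assume x: "x \<in> space M"
    have "(\<Prod>i\<in>J. g i x powr p i) = (\<Prod>i\<in>J. c i powr p i) * (\<Prod>i\<in>J. (g i x / c i) powr p i)"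
      unfolding prod.distrib[symmetric] 
      by (rule prod.cong[OF refl], subst powr_mult[symmetric]) (use c nn x in \<open>auto simp: less_imp_le less_imp_neq[THEN not_sym]\<close>)
    also have "\<dots> \<le> (\<Prod>i\<in>J. c i powr p i) * (\<Sum>i\<in>J. p i * (g i x / c i))"
      using nn x c by (intro mult_left_mono prod_powr_le_weighted_mean J p prod_nonneg) (auto simp: less_imp_le)
    finally show "(\<Prod>i\<in>J. g i x powr p i) \<le> (\<Prod>i\<in>J. c i powr p i) * (\<Sum>i\<in>J. p i * (g i x / c i))" .
    show "0 \<le> (\<Prod>i\<in>J. c i powr p i) * (\<Sum>i\<in>J. p i * (g i x / c i))"
      using nn x c p by (intro mult_nonneg_nonneg prod_nonneg sum_nonneg) (auto simp: less_imp_le)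
  qed
  also have "\<dots> = (\<Prod>i\<in>J. c i powr p i) * (\<Sum>i\<in>J. p i * ((\<integral>x. g i x \<partial>M) / c i))"
    using g by simp
  also have "\<dots> = (\<Prod>i\<in>J. c i powr p i)"
    unfolding c_def[symmetric] using c p(2) by (simp add: less_imp_neq[THEN not_sym])
  finally show ?thesis by (simp add: c_def)
qed

lemma integrable_bounded_nonneg:
  fixes f :: "'a \<Rightarrow> real"
  assumes "finite_measure M" "f \<in> borel_measurable M" "\<And>x. x \<in> space M \<Longrightarrow> 0 \<le> f x \<and> f x \<le> B"
  shows "integrable M f" "(\<integral>x. f x \<partial>M) \<le> B * measure M (space M)"
proof -
  interpret finite_measure M by fact
  show I: "integrable M f"
    by (rule integrable_const_bound[where B=B]) (use assms in auto)
  have "(\<integral>x. f x \<partial>M) \<le> (\<integral>x. B \<partial>M)"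
    by (rule integral_mono[OF I]) (use assms in auto)
  then show "(\<integral>x. f x \<partial>M) \<le> B * measure M (space M)"
    by (simp add: mult.commute)
qed

section \<open>Gagliardo's inequality for product measures\<close>

lemma finite_measure_PiM:
  assumes "finite I" "\<And>i. finite_measure (M i)"
  shows "finite_measure (PiM I M)"
proof
  interpret product_sigma_finite M
    using assms(2) finite_measure.axioms(1) by (auto simp: product_sigma_finite_def)
  have "emeasure (M i) (space (M i)) < \<infinity>" for i
    using finite_measure.finite_emeasure_space[OF assms(2)] by (simp add: top.not_eq_extremum)
  then show "emeasure (PiM I M) (space (PiM I M)) \<noteq> \<infinity>"
    unfolding space_PiM using assms(1)
    by (subst emeasure_PiM) (auto simp: ennreal_prod_eq_top less_top[symmetric])
qed

text \<open>The integral of \<open>H\<close> over the line through \<open>x\<close> in direction \<open>j\<close> is again bounded and measurable, whether or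
  not \<open>j\<close> belongs to the index set \<open>I\<close> of \<open>x\<close>. Both cases occur below: for \<open>j \<notin> I\<close> this is integrating out a
  new variable, for \<open>j \<in> I\<close> it replaces the variable \<open>x j\<close>.\<close>

context
  fixes M :: "'i \<Rightarrow> 'a measure" and I :: "'i set" and H :: "('i \<Rightarrow> 'a) \<Rightarrow> real" and B :: real and j :: 'i
  assumes fin: "finite I" "\<And>i. finite_measure (M i)"
    and H: "H \<in> borel_measurable (PiM (insert j I) M)"
    and bd: "\<And>x. x \<in> space (PiM (insert j I) M) \<Longrightarrow> 0 \<le> H x \<and> H x \<le> B"
begin

lemma fun_upd_in_space_PiM:
  "x \<in> space (PiM I M) \<Longrightarrow> t \<in> space (M j) \<Longrightarrow> x(j := t) \<in> space (PiM (insert j I) M)"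
  by (auto simp: space_PiM PiE_def extensional_def)

lemma measurable_along_line:
  assumes "x \<in> space (PiM I M)"
  shows "(\<lambda>t. H (x(j := t))) \<in> borel_measurable (M j)"
  using measurable_compose[OF measurable_compose[OF measurable_Pair1'[OF assms] measurable_add_dim] H]
  by simp

lemma line_integral_bounds:
  assumes "x \<in> space (PiM I M)"
  shows "0 \<le> (\<integral>t. H (x(j := t)) \<partial>M j) \<and> (\<integral>t. H (x(j := t)) \<partial>M j) \<le> B * measure (M j) (space (M j))"
  using integrable_bounded_nonneg(2)[OF fin(2) measurable_along_line[OF assms], of B]
    bd[OF fun_upd_in_space_PiM[OF assms]]
  by (auto intro!: Bochner_Integration.integral_nonneg)

lemma line_integral_measurable:
  "(\<lambda>x. \<integral>t. H (x(j := t)) \<partial>M j) \<in> borel_measurable (PiM I M)"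
proof -
  interpret finite_measure "M j" by (rule fin)
  show ?thesis
    using measurable_compose[OF measurable_add_dim H]
    by (intro borel_measurable_lebesgue_integral) (simp add: case_prod_beta')
qed

end

lemma integrable_powr_prod_line_integrals:
  fixes M :: "'i \<Rightarrow> 'a measure" and H :: "('i \<Rightarrow> 'a) \<Rightarrow> real"
  assumes fin: "finite I" "\<And>i. finite_measure (M i)"
    and H: "H \<in> borel_measurable (PiM I M)"
    and bd: "\<And>x. x \<in> space (PiM I M) \<Longrightarrow> 0 \<le> H x \<and> H x \<le> B"
    and cq: "0 \<le> c" "0 \<le> q"
  shows "integrable (PiM I M) (\<lambda>x. (if c = 0 then 1 else H x powr c) * (\<Prod>i\<in>I. (\<integral>t. H (x(i := t)) \<partial>M i) powr q))"
proof (rule integrable_bounded_nonneg(1)[OF finite_measure_PiM[OF fin]])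
  have meas: "(\<lambda>x. \<integral>t. H (x(i := t)) \<partial>M i) \<in> borel_measurable (PiM I M)" if "i \<in> I" for i
    using line_integral_measurable[where M=M and I=I and j=i and H=H and B=B] H bd fin that by (simp add: insert_absorb)
  have bound: "0 \<le> (\<integral>t. H (x(i := t)) \<partial>M i) \<and> (\<integral>t. H (x(i := t)) \<partial>M i) \<le> B * measure (M i) (space (M i))"
    if "i \<in> I" "x \<in> space (PiM I M)" for i x
    using line_integral_bounds[where M=M and I=I and j=i and H=H and B=B and x=x] H bd fin that by (simp add: insert_absorb)
  show "(\<lambda>x. (if c = 0 then 1 else H x powr c) * (\<Prod>i\<in>I. (\<integral>t. H (x(i := t)) \<partial>M i) powr q)) \<in> borel_measurable (PiM I M)"
    using meas H by measurable
  fix x assume x: "x \<in> space (PiM I M)"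
  show "0 \<le> (if c = 0 then 1 else H x powr c) * (\<Prod>i\<in>I. (\<integral>t. H (x(i := t)) \<partial>M i) powr q) \<and>
     (if c = 0 then 1 else H x powr c) * (\<Prod>i\<in>I. (\<integral>t. H (x(i := t)) \<partial>M i) powr q)
       \<le> (if c = 0 then 1 else B powr c) * (\<Prod>i\<in>I. (B * measure (M i) (space (M i))) powr q)"
    using bd[OF x] bound[OF _ x] cq powr_mono2[of c "H x" B]
    by (intro conjI mult_nonneg_nonneg prod_nonneg mult_mono prod_mono powr_mono2) auto
qed

text \<open>Gagliardo's inequality is the case \<open>c = 0\<close>, \<open>q = 1 / (card I - 1)\<close>. The additional power \<open>c\<close> of \<open>H\<close>
  makes the statement inductive. Integrate the left-hand side over \<open>x j\<close> and let \<open>H'\<close> be the integral of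
  \<open>H\<close> over \<open>x j\<close>: the factor for direction \<open>j\<close> is \<open>H' powr q\<close>, which does not depend on \<open>x j\<close>, and
  Hoelder's inequality with exponents \<open>c\<close> for \<open>H\<close> and \<open>q\<close> for each remaining direction turns the
  other factors into \<open>H' powr c\<close> and the line integrals of \<open>H'\<close>. This is the same expression for \<open>H'\<close> with
  one variable less and \<open>c + q\<close> in place of \<open>c\<close>, and the constraint on \<open>c\<close> and \<open>q\<close> is preserved.

  The case distinction stands for the power with \<open>0\<close> to the power \<open>0\<close> equal to one; with
  \<open>H x powr 0\<close> the points where \<open>H\<close> vanishes would be lost from the left-hand side. Finite measures and
  bounded \<open>H\<close> keep every function in the induction integrable.\<close>

lemma gagliardo_PiM:
  fixes M :: "'i \<Rightarrow> 'a measure" and H :: "('i \<Rightarrow> 'a) \<Rightarrow> real"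
  assumes fin: "finite I" "\<And>i. finite_measure (M i)"
    and H: "H \<in> borel_measurable (PiM I M)"
    and bd: "\<And>x. x \<in> space (PiM I M) \<Longrightarrow> 0 \<le> H x \<and> H x \<le> B"
    and cq: "0 \<le> c" "0 < q" "c + (real (card I) - 1) * q = 1"
  shows "(\<integral>x. (if c = 0 then 1 else H x powr c) * (\<Prod>i\<in>I. (\<integral>t. H (x(i := t)) \<partial>M i) powr q) \<partial>PiM I M)
         \<le> (\<integral>x. H x \<partial>PiM I M) powr (c + real (card I) * q)"
  using assms
proof (induction I arbitrary: H B c rule: finite_induct)
  case empty
  then show ?case by (simp add: PiM_empty lebesgue_integral_count_space_finite)
next
  case (insert j I)
  interpret product_sigma_finite M
    using fin(2) finite_measure.axioms(1) by (auto simp: product_sigma_finite_def)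
  have finM: "finite_measure (M i)" for i by (rule fin)
  note H = \<open>H \<in> borel_measurable (PiM (insert j I) M)\<close>
  note bd = \<open>\<And>x. x \<in> space (PiM (insert j I) M) \<Longrightarrow> 0 \<le> H x \<and> H x \<le> B\<close>
  note line = \<open>finite I\<close> finM H bd
  define H' where "H' x = (\<integral>t. H (x(j := t)) \<partial>M j)" for x
  define F where "F x = (if c = 0 then 1 else H x powr c) * (\<Prod>i\<in>insert j I. (\<integral>t. H (x(i := t)) \<partial>M i) powr q)" for x
  have cq: "0 \<le> c" "0 < q" "c + real (card I) * q = 1"
    using insert by auto
  have H': "H' \<in> borel_measurable (PiM I M)"
    unfolding H'_def by (rule line_integral_measurable[OF line])
  have bd': "0 \<le> H' x \<and> H' x \<le> B * measure (M j) (space (M j))" if "x \<in> space (PiM I M)" for x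
    unfolding H'_def by (rule line_integral_bounds[OF line that])
  have intF: "integrable (PiM (insert j I) M) F"
    unfolding F_def
    by (rule integrable_powr_prod_line_integrals[OF _ finM H bd]) (use insert cq in auto)
  have intH: "integrable (PiM (insert j I) M) H"
    by (rule integrable_bounded_nonneg(1)[OF finite_measure_PiM[OF _ finM] H bd]) (use insert in auto)
  have inner: "(\<integral>t. F (x(j := t)) \<partial>M j)
      \<le> H' x powr (c + q) * (\<Prod>i\<in>I. (\<integral>s. H' (x(i := s)) \<partial>M i) powr q)"
    if x: "x \<in> space (PiM I M)" for x
  proof -
    have xt: "x(j := t) \<in> space (PiM (insert j I) M)" if "t \<in> space (M j)" for t
      using fun_upd_in_space_PiM[OF line x that] .
    \<comment> \<open>Fubini: integrating the line integrals of \<open>H\<close> over \<open>x j\<close> gives the line integrals of \<open>H'\<close>.\<close>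
    have swap: "(\<integral>t. (\<integral>s. H (x(j := t, i := s)) \<partial>M i) \<partial>M j) = (\<integral>s. H' (x(i := s)) \<partial>M i)"
      and int: "integrable (M j) (\<lambda>t. \<integral>s. H (x(j := t, i := s)) \<partial>M i)"
      and nn: "\<And>t. t \<in> space (M j) \<Longrightarrow> 0 \<le> (\<integral>s. H (x(j := t, i := s)) \<partial>M i)"
      if i: "i \<in> I" for i
    proof -
      interpret Mj: finite_measure "M j" by (rule fin)
      interpret Mi: finite_measure "M i" by (rule fin)
      interpret P: pair_sigma_finite "M j" "M i" ..
      have ij: "i \<noteq> j" using i insert by auto
      have 1: "(\<lambda>p. x(j := fst p, i := snd p)) \<in> M j \<Otimes>\<^sub>M M i \<rightarrow>\<^sub>M PiM (insert j I) M"
      proof -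
        have "(\<lambda>p. (x(j := fst p), snd p)) \<in> M j \<Otimes>\<^sub>M M i \<rightarrow>\<^sub>M PiM (insert j I) M \<Otimes>\<^sub>M M i"
          using measurable_compose[OF measurable_fst measurable_component_update[OF x \<open>j \<notin> I\<close>], of "M i"]
          by (intro measurable_Pair) auto
        from measurable_compose[OF this measurable_add_dim] show ?thesis
          using i by (simp add: insert_absorb)
      qed
      have fp: "finite_measure (M j \<Otimes>\<^sub>M M i)"
        by (intro finite_measure_pair_measure fin)
      have I: "integrable (M j \<Otimes>\<^sub>M M i) (\<lambda>(t, s). H (x(j := t, i := s)))"
        using measurable_compose[OF 1 H] bd measurable_space[OF 1]
        by (intro integrable_bounded_nonneg(1)[OF fp, of _ B]) (auto simp: case_prod_beta')
      show "integrable (M j) (\<lambda>t. \<integral>s. H (x(j := t, i := s)) \<partial>M i)"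
        by (rule P.integrable_fst[OF I])
      show "(\<integral>t. (\<integral>s. H (x(j := t, i := s)) \<partial>M i) \<partial>M j) = (\<integral>s. H' (x(i := s)) \<partial>M i)"
        unfolding H'_def using P.Fubini_integral[OF I] ij by (simp add: fun_upd_twist)
      show "0 \<le> (\<integral>s. H (x(j := t, i := s)) \<partial>M i)" if "t \<in> space (M j)" for t
      proof (rule Bochner_Integration.integral_nonneg)
        fix s assume "s \<in> space (M i)"
        then have "x(j := t, i := s) \<in> space (PiM (insert j I) M)"
          using measurable_space[OF 1, of "(t, s)"] that by (simp add: space_pair_measure)
        then show "0 \<le> H (x(j := t, i := s))" using bd by auto
      qed
    qed
    \<comment> \<open>Hoelder's inequality over the family consisting of \<open>H\<close>, indexed by \<open>j\<close>, and the line integrals in the directions \<open>i \<in> I\<close>; for \<open>c = 0\<close> the function \<open>H\<close> is left out.\<close>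
    define p where "p i = (if i = j then c else q)" for i
    define g where "g i t = (if i = j then H (x(j := t)) else (\<integral>s. H (x(j := t, i := s)) \<partial>M i))" for i t
    have gj: "g j t = H (x(j := t))" "p j = c" for t by (auto simp: g_def p_def)
    have gi: "g i t = (\<integral>s. H (x(j := t, i := s)) \<partial>M i)" "p i = q" if "i \<in> I" for i t
      using that insert by (auto simp: g_def p_def)
    define J where "J = (if c = 0 then I else insert j I)"
    have J: "finite J" "J \<subseteq> insert j I" using insert.hyps by (auto simp: J_def)
    have "(\<integral>t. F (x(j := t)) \<partial>M j) = (\<integral>t. H' x powr q * (\<Prod>i\<in>J. g i t powr p i) \<partial>M j)"
    proof (rule Bochner_Integration.integral_cong[OF refl])
      fix t
      have "(\<Prod>i\<in>J. g i t powr p i)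
          = (if c = 0 then 1 else H (x(j := t)) powr c) * (\<Prod>i\<in>I. (\<integral>s. H (x(j := t, i := s)) \<partial>M i) powr q)"
        using insert by (simp add: gj gi J_def)
      then show "F (x(j := t)) = H' x powr q * (\<Prod>i\<in>J. g i t powr p i)"
        using insert by (simp add: F_def H'_def)
    qed
    also have "\<dots> = H' x powr q * (\<integral>t. (\<Prod>i\<in>J. g i t powr p i) \<partial>M j)"
      by simp
    also have "\<dots> \<le> H' x powr q * (\<Prod>i\<in>J. (\<integral>t. g i t \<partial>M j) powr p i)"
    proof (intro mult_left_mono Holder_integral_prod)
      show "(\<Sum>i\<in>J. p i) = 1"
        using insert cq by (simp add: gj gi J_def)
      show "integrable (M j) (g i)" if "i \<in> J" for i
        using that J int[of i] integrable_bounded_nonneg(1)[OF finM measurable_along_line[OF line x], of B] bd[OF xt]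
        by (cases "i = j") (auto simp: g_def[abs_def])
      show "0 \<le> g i t" if "i \<in> J" "t \<in> space (M j)" for i t
        using that J nn[of i] bd[OF xt] by (cases "i = j") (auto simp: g_def[abs_def])
    qed (use J cq in \<open>auto simp: p_def\<close>)
    also have "(\<Prod>i\<in>J. (\<integral>t. g i t \<partial>M j) powr p i)
        = (if c = 0 then 1 else H' x powr c) * (\<Prod>i\<in>I. (\<integral>s. H' (x(i := s)) \<partial>M i) powr q)"
    proof -
      have "(\<integral>t. g i t \<partial>M j) powr p i = (\<integral>s. H' (x(i := s)) \<partial>M i) powr q" if "i \<in> I" for i
        using that by (simp only: gi swap)
      moreover have "(\<integral>t. g j t \<partial>M j) powr p j = H' x powr c"
        by (simp only: gj H'_def)
      ultimately show ?thesis using insert.hyps by (simp add: J_def)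
    qed
    finally have le: "(\<integral>t. F (x(j := t)) \<partial>M j)
      \<le> H' x powr q * ((if c = 0 then 1 else H' x powr c) * (\<Prod>i\<in>I. (\<integral>s. H' (x(i := s)) \<partial>M i) powr q))" .
    have "H' x powr (c + q) = H' x powr q * (if c = 0 then 1 else H' x powr c)"
      by (simp add: powr_add)
    with le show ?thesis by (simp only: mult.assoc)
  qed
  have cq': "c + q \<noteq> 0" "0 \<le> c + q" "0 \<le> q" using cq by auto
  have "(\<integral>x. F x \<partial>PiM (insert j I) M) = (\<integral>x. (\<integral>t. F (x(j := t)) \<partial>M j) \<partial>PiM I M)"
    using insert intF by (intro product_integral_insert)
  also have "\<dots> \<le> (\<integral>x. H' x powr (c + q) * (\<Prod>i\<in>I. (\<integral>s. H' (x(i := s)) \<partial>M i) powr q) \<partial>PiM I M)"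
  proof (rule integral_mono'[OF _ inner])
    show "integrable (PiM I M) (\<lambda>x. H' x powr (c + q) * (\<Prod>i\<in>I. (\<integral>s. H' (x(i := s)) \<partial>M i) powr q))"
      using integrable_powr_prod_line_integrals[OF \<open>finite I\<close> finM H' bd' cq'(2,3)] cq'(1) by simp
  qed (auto intro!: mult_nonneg_nonneg prod_nonneg)
  also have "\<dots> \<le> (\<integral>x. H' x \<partial>PiM I M) powr ((c + q) + real (card I) * q)"
    using insert.IH[OF finM H' bd' cq'(2) cq(2)] cq cq'(1) by (simp add: algebra_simps del: fun_upd_apply)
  also have "(\<integral>x. H' x \<partial>PiM I M) = (\<integral>x. H x \<partial>PiM (insert j I) M)"
    unfolding H'_def using insert intH by (intro product_integral_insert[symmetric])
  also have "(c + q) + real (card I) * q = c + real (card (insert j I)) * q"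
    using insert.hyps by (simp add: algebra_simps)
  finally show ?case unfolding F_def .
qed

section \<open>Gagliardo's inequality in Euclidean space\<close>

lemma PiM_density_indicator:
  fixes I :: "'i set"
  assumes "finite I"
  shows "(\<Pi>\<^sub>M i\<in>I. density lborel (indicator {-1..1::real})) =
    density (\<Pi>\<^sub>M i\<in>I. lborel) (\<lambda>x. ennreal (\<Prod>i\<in>I. indicator {-1..1} (x i)))"
proof -
  interpret L: product_sigma_finite "\<lambda>i::'i. lborel :: real measure" by standard
  have fin: "finite_measure (density lborel (indicator {-1..1::real}))"
    by (intro finite_measureI) (simp add: emeasure_density)
  interpret D: product_sigma_finite "\<lambda>i::'i. density lborel (indicator {-1..1::real})"
    using finite_measure.axioms(1)[OF fin] by (auto simp: product_sigma_finite_def)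
  show ?thesis
  proof (rule D.PiM_eqI[OF assms, symmetric])
    show "sets (density (Pi\<^sub>M I (\<lambda>i. lborel)) (\<lambda>x. ennreal (\<Prod>i\<in>I. indicator {-1..1} (x i)))) =
      sets (\<Pi>\<^sub>M i\<in>I. density lborel (indicator {-1..1::real}))"
      by (simp cong: sets_PiM_cong)
    fix A :: "'i \<Rightarrow> real set" assume A: "\<And>i. i \<in> I \<Longrightarrow> A i \<in> sets (density lborel (indicator {-1..1::real}))"
    then have [measurable]: "\<And>i. i \<in> I \<Longrightarrow> A i \<in> sets borel" by simp
    have "emeasure (density (Pi\<^sub>M I (\<lambda>i. lborel)) (\<lambda>x. ennreal (\<Prod>i\<in>I. indicator {-1..1} (x i)))) (Pi\<^sub>E I A)
       = (\<integral>\<^sup>+x. ennreal (\<Prod>i\<in>I. indicator {-1..1} (x i)) * indicator (Pi\<^sub>E I A) x \<partial>Pi\<^sub>M I (\<lambda>i. lborel))"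
      using assms by (intro emeasure_density) (auto intro!: sets_PiM_I_finite)
    also have "\<dots> = (\<integral>\<^sup>+x. (\<Prod>i\<in>I. indicator ({-1..1} \<inter> A i) (x i)) \<partial>Pi\<^sub>M I (\<lambda>i. lborel))"
    proof (rule nn_integral_cong)
      fix x :: "'i \<Rightarrow> real" assume x: "x \<in> space (Pi\<^sub>M I (\<lambda>i. lborel))"
      then have "indicator (Pi\<^sub>E I A) x = (\<Prod>i\<in>I. indicator (A i) (x i) :: ennreal)"
        using assms by (auto simp: indicator_def space_PiM PiE_def Pi_def prod_zero)
      then show "ennreal (\<Prod>i\<in>I. indicator {-1..1} (x i)) * indicator (Pi\<^sub>E I A) x
         = (\<Prod>i\<in>I. indicator ({-1..1} \<inter> A i) (x i))"
        by (simp add: prod_ennreal[symmetric] ennreal_indicator indicator_inter_arith prod.distrib)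
    qed
    also have "\<dots> = (\<Prod>i\<in>I. \<integral>\<^sup>+t. indicator ({-1..1} \<inter> A i) t \<partial>lborel)"
      using assms by (intro L.product_nn_integral_prod) auto
    also have "\<dots> = (\<Prod>i\<in>I. emeasure (density lborel (indicator {-1..1::real})) (A i))"
      by (intro prod.cong refl) (simp add: emeasure_density indicator_inter_arith[symmetric])
    finally show "emeasure (density (Pi\<^sub>M I (\<lambda>i. lborel)) (\<lambda>x. ennreal (\<Prod>i\<in>I. indicator {-1..1} (x i)))) (Pi\<^sub>E I A)
      = (\<Prod>i\<in>I. emeasure (density lborel (indicator {-1..1::real})) (A i))" .
  qed
qed

lemma integral_lborel_eq_PiM_box:
  fixes g :: "'a::euclidean_space \<Rightarrow> real"
  assumes [measurable]: "g \<in> borel_measurable borel" and z: "\<And>z. z \<notin> cbox (-One) One \<Longrightarrow> g z = 0"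
  shows "(\<integral>z. g z \<partial>lborel)
    = (\<integral>x. g (\<Sum>b\<in>Basis. x b *\<^sub>R b) \<partial>(\<Pi>\<^sub>M b\<in>(Basis::'a set). density lborel (indicator {-1..1})))"
proof -
  let ?L = "\<Pi>\<^sub>M b\<in>(Basis::'a set). (lborel :: real measure)"
  have "(\<integral>z. g z \<partial>lborel) = (\<integral>x. g (\<Sum>b\<in>Basis. x b *\<^sub>R b) \<partial>?L)"
    by (subst lborel_eq) (simp add: integral_distr)
  also have "\<dots> = (\<integral>x. (\<Prod>b\<in>(Basis::'a set). indicator {-1..1} (x b)) *\<^sub>R g (\<Sum>b\<in>Basis. x b *\<^sub>R b) \<partial>?L)"
  proof (rule Bochner_Integration.integral_cong[OF refl])
    fix x :: "'a \<Rightarrow> real"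
    show "g (\<Sum>b\<in>Basis. x b *\<^sub>R b) = (\<Prod>b\<in>(Basis::'a set). indicator {-1..1} (x b)) *\<^sub>R g (\<Sum>b\<in>Basis. x b *\<^sub>R b)"
    proof (cases "\<forall>b\<in>(Basis::'a set). x b \<in> {-1..1}")
      case False
      then have "(\<Sum>b\<in>Basis. x b *\<^sub>R b) \<notin> cbox (-One) One"
        by (auto simp: mem_box)
      then show ?thesis using z by simp
    qed simp
  qed
  also have "\<dots> = (\<integral>x. g (\<Sum>b\<in>Basis. x b *\<^sub>R b) \<partial>density ?L (\<lambda>x. ennreal (\<Prod>b\<in>(Basis::'a set). indicator {-1..1} (x b))))"
    by (subst integral_density) (auto intro!: prod_nonneg)
  finally show ?thesis by (simp add: PiM_density_indicator)
qed

text \<open>A function \<open>w\<close> dominated by the geometric product of the line integrals of \<open>H\<close> is integrated by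
  \<open>gagliardo_PiM\<close> in the coordinates of the standard basis. All functions live in the box
  \<open>cbox (-One) One\<close>, so Lebesgue measure may be replaced by the product of its restrictions to
  \<open>{-1..1}\<close>, which are finite measures.\<close>

lemma gagliardo_lborel:
  fixes H w :: "'a::euclidean_space \<Rightarrow> real"
  assumes dim: "DIM('a) \<ge> 2"
    and H[measurable]: "H \<in> borel_measurable borel" and bd: "\<And>z. 0 \<le> H z \<and> H z \<le> B"
    and H0: "\<And>z. z \<notin> cbox (-One) One \<Longrightarrow> H z = 0"
    and w[measurable]: "w \<in> borel_measurable borel" and w0: "\<And>z. z \<notin> cbox (-One) One \<Longrightarrow> w z = 0"
    and le: "\<And>z. z \<in> cbox (-One) One \<Longrightarrow>
      w z \<le> (\<Prod>b\<in>Basis. (\<integral>t. H (z + t *\<^sub>R b) \<partial>lborel) powr (1 / (real DIM('a) - 1)))"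
  shows "(\<integral>z. w z \<partial>lborel) \<le> (\<integral>z. H z \<partial>lborel) powr (real DIM('a) / (real DIM('a) - 1))"
proof -
  define D where "D = density lborel (indicator {-1..1::real})"
  define P where "P = (\<Pi>\<^sub>M b\<in>(Basis::'a set). D)"
  define e where "e x = (\<Sum>b\<in>Basis. x b *\<^sub>R b)" for x :: "'a \<Rightarrow> real"
  define q where "q = 1 / (real DIM('a) - 1)"
  have q: "q > 0" "real DIM('a) * q = 1 + q" using dim by (auto simp: q_def field_simps)
  have fin: "finite_measure D"
    unfolding D_def by (intro finite_measureI) (simp add: emeasure_density)
  have [measurable_cong]: "sets D = sets borel" by (simp add: D_def)
  have [measurable]: "e \<in> borel_measurable P"
    unfolding e_def P_def by measurable
  have ebox: "e x \<in> cbox (-One) One \<longleftrightarrow> (\<forall>b\<in>Basis. x b \<in> {-1..1})" for x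
    by (auto simp: e_def mem_box)
  have line: "(\<integral>t. H (e (x(b := t))) \<partial>D) = (\<integral>t. H (e x + t *\<^sub>R b) \<partial>lborel)"
    if b: "b \<in> Basis" for b and x :: "'a \<Rightarrow> real"
  proof -
    have upd: "e (x(b := t)) = e x + (t - x b) *\<^sub>R b" for t
    proof -
      have "(\<Sum>c\<in>Basis. (x(b := t)) c *\<^sub>R c) = (\<Sum>c\<in>Basis. x c *\<^sub>R c + (if c = b then (t - x b) *\<^sub>R b else 0))"
        by (rule sum.cong) (auto simp: algebra_simps)
      then show ?thesis using b by (simp add: e_def sum.distrib)
    qed
    have "(\<integral>t. H (e (x(b := t))) \<partial>D) = (\<integral>t. indicator {-1..1} t *\<^sub>R H (e (x(b := t))) \<partial>lborel)"
      unfolding D_def upd ennreal_indicator[symmetric]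
      by (subst integral_density) auto
    also have "\<dots> = (\<integral>t. H (e (x(b := t))) \<partial>lborel)"
    proof (rule Bochner_Integration.integral_cong[OF refl])
      fix t :: real
      have "e (x(b := t)) \<notin> cbox (-One) One" if "t \<notin> {-1..1}"
        using that b by (auto simp: ebox)
      then show "indicator {-1..1} t *\<^sub>R H (e (x(b := t))) = H (e (x(b := t)))"
        using H0 by (cases "t \<in> {-1..1}") auto
    qed
    also have "\<dots> = (\<integral>t. H (e x + t *\<^sub>R b) \<partial>lborel)"
      unfolding upd by (subst lborel_integral_real_affine[where c=1 and t="x b"]) auto
    finally show ?thesis .
  qed
  have PM: "(\<lambda>x. H (e x)) \<in> borel_measurable (PiM Basis (\<lambda>_. D))"
    unfolding P_def[symmetric] by measurable
  have bdP: "0 \<le> H (e x) \<and> H (e x) \<le> B" for x using bd by blast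
  have card: "(0::real) + (real (card (Basis::'a set)) - 1) * q = 1"
    using dim by (simp add: q_def)
  have int: "integrable P (\<lambda>x. \<Prod>b\<in>Basis. (\<integral>t. H (e (x(b := t))) \<partial>D) powr q)"
    using integrable_powr_prod_line_integrals[OF finite_Basis fin PM bdP order_refl less_imp_le[OF q(1)]]
    by (simp add: P_def del: fun_upd_apply)
  \<comment> \<open>The case \<open>c = 0\<close> of the product inequality, in which the power of \<open>H\<close> is absent.\<close>
  have "(\<integral>z. w z \<partial>lborel) = (\<integral>x. w (e x) \<partial>P)"
    unfolding P_def e_def D_def by (rule integral_lborel_eq_PiM_box[OF w w0])
  also have "\<dots> \<le> (\<integral>x. (\<Prod>b\<in>Basis. (\<integral>t. H (e (x(b := t))) \<partial>D) powr q) \<partial>P)"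
  proof (rule integral_mono'[OF int])
    fix x
    show "w (e x) \<le> (\<Prod>b\<in>Basis. (\<integral>t. H (e (x(b := t))) \<partial>D) powr q)"
    proof (cases "e x \<in> cbox (-One) One")
      case True
      then show ?thesis using le[OF True] by (simp add: line q_def del: fun_upd_apply)
    next
      case False
      then show ?thesis by (simp add: w0 prod_nonneg del: fun_upd_apply)
    qed
  qed (simp add: prod_nonneg)
  also have "\<dots> \<le> (\<integral>x. H (e x) \<partial>P) powr (1 + q)"
    using gagliardo_PiM[OF finite_Basis fin PM bdP order_refl q(1) card] q(2)
    by (simp add: P_def del: fun_upd_apply)
  also have "(\<integral>x. H (e x) \<partial>P) = (\<integral>z. H z \<partial>lborel)"
    unfolding P_def e_def D_def by (rule integral_lborel_eq_PiM_box[OF H H0, symmetric])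
  also have "1 + q = real DIM('a) / (real DIM('a) - 1)"
    using dim by (simp add: q_def field_simps)
  finally show ?thesis .
qed

section \<open>Differentiation of powers and of compactly supported functions\<close>

lemma has_real_derivative_abs_powr:
  fixes y s :: real
  assumes "s > 1"
  shows "((\<lambda>y. \<bar>y\<bar> powr s) has_real_derivative s * \<bar>y\<bar> powr (s - 1) * sgn y) (at y)"
proof -
  consider "y > 0" | "y < 0" | "y = 0" by linarith
  then show ?thesis
  proof cases
    case 1
    have "((\<lambda>y. y powr s) has_real_derivative s * \<bar>y\<bar> powr (s - 1) * sgn y) (at y)"
      using has_real_derivative_powr[OF 1, of s] 1 by simp
    then show ?thesis
      by (rule has_field_derivative_transform_within[of _ _ _ _ y]) (use 1 in \<open>auto simp: dist_real_def\<close>)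
  next
    case 2
    have "((\<lambda>y. (- y) powr s) has_real_derivative s * \<bar>y\<bar> powr (s - 1) * sgn y) (at y)"
      using DERIV_mirror[of "\<lambda>y. y powr s" y] has_real_derivative_powr[of "- y" s] 2
      by (auto intro!: derivative_eq_intros)
    then show ?thesis
      by (rule has_field_derivative_transform_within[of _ _ _ _ "- y"]) (use 2 in \<open>auto simp: dist_real_def\<close>)
  next
    case 3
    have "((\<lambda>h. \<bar>h\<bar> powr (s - 1)) \<longlongrightarrow> \<bar>0\<bar> powr (s - 1)) (at (0::real))"
      using assms by (intro tendsto_powr' tendsto_rabs tendsto_ident_at tendsto_const) auto
    then have lim: "((\<lambda>h::real. \<bar>h\<bar> powr (s - 1)) \<longlongrightarrow> 0) (at 0)"
      by simp
    have bound: "norm (\<bar>h\<bar> powr s / h) \<le> \<bar>h\<bar> powr (s - 1)" for h :: real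
      by (cases "h = 0") (auto simp: powr_diff)
    have "\<forall>h::real. norm (\<bar>h\<bar> powr s / h) \<le> norm (\<bar>h\<bar> powr (s - 1)) * 1"
      using bound by simp
    then have "((\<lambda>h::real. \<bar>h\<bar> powr s / h) \<longlongrightarrow> 0) (at 0)"
      by (rule tendsto_0_le[where K=1, OF lim always_eventually])
    then show ?thesis using 3 assms by (simp add: DERIV_def)
  qed
qed

lemma abs_powr_increment_le:
  fixes \<phi> \<phi>' :: "real \<Rightarrow> real"
  assumes "s > 1" "a \<le> b" and d: "\<And>t. (\<phi> has_real_derivative \<phi>' t) (at t)"
    and c: "continuous_on UNIV \<phi>'"
  shows "\<bar>\<bar>\<phi> b\<bar> powr s - \<bar>\<phi> a\<bar> powr s\<bar> \<le> (LBINT t:{a..b}. s * \<bar>\<phi> t\<bar> powr (s - 1) * \<bar>\<phi>' t\<bar>)"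
proof -
  define f where "f t = s * \<bar>\<phi> t\<bar> powr (s - 1) * sgn (\<phi> t) * \<phi>' t" for t
  define g where "g t = s * \<bar>\<phi> t\<bar> powr (s - 1) * \<bar>\<phi>' t\<bar>" for t
  have "continuous_on UNIV \<phi>"
    using d by (meson DERIV_isCont continuous_at_imp_continuous_on)
  then have cg: "continuous_on {a..b} g"
    unfolding g_def using assms c
    by (intro continuous_intros continuous_on_powr' continuous_on_subset[OF c]) (auto intro: continuous_on_subset)
  have f: "(f has_integral (\<bar>\<phi> b\<bar> powr s - \<bar>\<phi> a\<bar> powr s)) {a..b}"
  proof (rule fundamental_theorem_of_calculus[OF \<open>a \<le> b\<close>])
    fix t
    show "((\<lambda>t. \<bar>\<phi> t\<bar> powr s) has_vector_derivative f t) (at t within {a..b})"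
      using DERIV_chain2[OF has_real_derivative_abs_powr[OF \<open>s > 1\<close>] d]
      unfolding f_def has_real_derivative_iff_has_vector_derivative by (rule has_vector_derivative_at_within)
  qed
  \<comment> \<open>The gauge integral of \<open>f\<close> exists by the fundamental theorem alone; only the dominating \<open>g\<close> has to be continuous.\<close>
  have "norm (integral {a..b} f) \<le> integral {a..b} g"
    using f integrable_continuous_real[OF cg] \<open>s > 1\<close>
    by (intro integral_norm_bound_integral) (auto simp: g_def f_def abs_mult abs_sgn_eq)
  also have "integral {a..b} g = (LBINT t:{a..b}. g t)"
    using borel_integrable_atLeastAtMost'[OF cg] by (simp add: set_borel_integral_eq_integral)
  finally show ?thesis using f by (simp add: integral_unique g_def)
qed

text \<open>The regularity used later: one continuous derivative, and a compact set \<open>S\<close> off which both \<open>f\<close> and its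
  derivative vanish.\<close>

lemma C0_infinity_props:
  assumes "f \<in> C0_infinity U"
  shows "f differentiable (at z)" "continuous_on UNIV f"
    "continuous_on UNIV (\<lambda>z. frechet_derivative f (at z) v)"
    "\<exists>S\<subseteq>U. compact S \<and> (\<forall>z. z \<notin> S \<longrightarrow> f z = 0 \<and> frechet_derivative f (at z) = (\<lambda>_. 0))"
proof -
  have C: "C_k 0 f" "C_k (Suc 0) f" and S: "compact (closure (support_on UNIV f))" "closure (support_on UNIV f) \<subseteq> U"
    using assms unfolding C0_infinity_def smooth_def by blast+
  then show "f differentiable (at z)" "continuous_on UNIV f"
    "continuous_on UNIV (\<lambda>z. frechet_derivative f (at z) v)"
    by auto
  define S where "S = closure (support_on UNIV f)"
  have "f z = 0 \<and> frechet_derivative f (at z) = (\<lambda>_. 0)" if "z \<notin> S" for z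
  proof
    have z: "f y = 0" if "y \<in> - S" for y
      using that closure_subset[of "support_on UNIV f"] by (auto simp: S_def support_on_def)
    then show "f z = 0" using that by simp
    have "((\<lambda>_. 0) has_derivative (\<lambda>_. 0)) (at z)" by simp
    then have "(f has_derivative (\<lambda>_. 0)) (at z)"
      by (rule has_derivative_transform_within_open[of _ _ _ _ "- S"]) (use that z S_def in auto)
    then show "frechet_derivative f (at z) = (\<lambda>_. 0)"
      using frechet_derivative_at by metis
  qed
  then show "\<exists>S\<subseteq>U. compact S \<and> (\<forall>z. z \<notin> S \<longrightarrow> f z = 0 \<and> frechet_derivative f (at z) = (\<lambda>_. 0))"
    using S S_def by blast
qed

lemma C0_infinity_eq_0: "f \<in> C0_infinity U \<Longrightarrow> z \<notin> U \<Longrightarrow> f z = 0"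
  using C0_infinity_props(4)[of f U] by blast

lemma grad_x_inner:
  assumes "f differentiable (at z)"
  shows "grad_x f z \<bullet> v = frechet_derivative f (at z) (v, 0)"
proof -
  obtain x l where z: "z = (x, l)" by force
  define L where "L v = frechet_derivative f (at z) (v, 0)" for v
  have f: "(f has_derivative frechet_derivative f (at z)) (at (x, l))"
    using assms z frechet_derivative_works by blast
  have "((\<lambda>y. (y, l)) has_derivative (\<lambda>v. (v, 0))) (at x)"
    by (auto intro!: derivative_eq_intros)
  from diff_chain_at[OF this f] have L: "((\<lambda>y. f (y, l)) has_derivative L) (at x)"
    unfolding o_def L_def[abs_def] .
  define D where "D = adjoint L 1"
  have D: "L v = v \<bullet> D" for v
    using adjoint_works[OF has_derivative_linear[OF L], of v 1] by (simp add: D_def)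
  have "GDERIV (\<lambda>y. f (y, l)) x :> D"
    using L unfolding gderiv_def D[abs_def] .
  moreover have "D' = D" if "GDERIV (\<lambda>y. f (y, l)) x :> D'" for D'
  proof -
    have "(\<lambda>v. v \<bullet> D') = L"
      using that L unfolding gderiv_def by (rule has_derivative_unique)
    from fun_cong[OF this] D have "v \<bullet> D' = v \<bullet> D" for v
      by (rule trans)
    then have "\<forall>v. v \<bullet> D' = v \<bullet> D" by simp
    then show ?thesis by (simp only: vector_eq_ldot)
  qed
  ultimately have "grad_x f z = D"
    unfolding grad_x_def z prod.case by (rule the_equality)
  then show ?thesis using D[of v] by (simp add: L_def inner_commute)
qed

lemma partial_l_eq:
  assumes "f differentiable (at z)"
  shows "partial_l f z = frechet_derivative f (at z) (0, 1)"
proof -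
  obtain x l where z: "z = (x, l)" by force
  have f: "(f has_derivative frechet_derivative f (at z)) (at (x, l))"
    using assms z frechet_derivative_works by blast
  have "((\<lambda>s. (x, s)) has_derivative (\<lambda>v. (0, v))) (at l)"
    by (auto intro!: derivative_eq_intros)
  from diff_chain_at[OF this f]
  have L: "((\<lambda>s. f (x, s)) has_derivative (\<lambda>v. frechet_derivative f (at z) (0, v))) (at l)"
    unfolding o_def .
  have lin: "(\<lambda>v. frechet_derivative f (at z) (0, v)) = (*) (frechet_derivative f (at z) (0, 1))"
  proof
    fix v
    show "frechet_derivative f (at z) (0, v) = frechet_derivative f (at z) (0, 1) * v"
      using linear_cmul[OF linear_frechet_derivative[OF assms], of v "(0, 1)"] by (simp add: mult.commute)
  qed
  from L have "((\<lambda>s. f (x, s)) has_real_derivative frechet_derivative f (at z) (0, 1)) (at l)"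
    unfolding has_field_derivative_def lin .
  then show ?thesis unfolding partial_l_def z by (simp add: DERIV_imp_deriv)
qed

text \<open>Length of the gradient for the metric \<open>dx\<^sup>2 + d\<lambda>\<^sup>2 / (1 - \<bar>\<lambda>\<bar>)\<^sup>2\<close>, whose unit vector in the \<open>\<lambda>\<close> direction
  is \<open>(1 - \<bar>\<lambda>\<bar>) \<partial>\<^sub>\<lambda>\<close>.\<close>

definition weighted_grad_norm :: "((real ^ 'n) \<times> real \<Rightarrow> real) \<Rightarrow> (real ^ 'n) \<times> real \<Rightarrow> real" where
  "weighted_grad_norm f z = sqrt ((norm (grad_x f z))\<^sup>2 + (1 - \<bar>snd z\<bar>)\<^sup>2 * \<bar>partial_l f z\<bar>\<^sup>2)"

lemma weighted_grad_norm_props: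
  fixes f :: "(real ^ 'n) \<times> real \<Rightarrow> real"
  assumes f: "f \<in> C0_infinity U"
  shows "0 \<le> weighted_grad_norm f z"
    "norm i = 1 \<Longrightarrow> \<bar>frechet_derivative f (at z) (i, 0)\<bar> \<le> weighted_grad_norm f z"
    "(1 - \<bar>snd z\<bar>) * \<bar>frechet_derivative f (at z) (0, 1)\<bar> \<le> weighted_grad_norm f z"
    "frechet_derivative f (at z) = (\<lambda>_. 0) \<Longrightarrow> weighted_grad_norm f z = 0"
    "continuous_on UNIV (weighted_grad_norm f)"
proof -
  note d = C0_infinity_props(1)[OF f]
  show "0 \<le> weighted_grad_norm f z" by (simp add: weighted_grad_norm_def)
  show "\<bar>frechet_derivative f (at z) (i, 0)\<bar> \<le> weighted_grad_norm f z" if "norm i = 1"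
  proof -
    have "\<bar>frechet_derivative f (at z) (i, 0)\<bar> \<le> norm (grad_x f z)"
      using Cauchy_Schwarz_ineq2[of "grad_x f z" i] that by (simp add: grad_x_inner[OF d])
    also have "\<dots> \<le> weighted_grad_norm f z"
      unfolding weighted_grad_norm_def by (rule real_le_rsqrt) simp
    finally show ?thesis .
  qed
  show "(1 - \<bar>snd z\<bar>) * \<bar>frechet_derivative f (at z) (0, 1)\<bar> \<le> weighted_grad_norm f z"
    unfolding weighted_grad_norm_def partial_l_eq[OF d]
    by (rule real_le_rsqrt) (simp add: power_mult_distrib)
  \<comment> \<open>Parseval expresses the norm of the gradient through finitely many directional derivatives, which are continuous.\<close>
  have sq: "(norm (grad_x f z))\<^sup>2 = (\<Sum>i\<in>Basis. (frechet_derivative f (at z) (i, 0))\<^sup>2)" for z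
    unfolding power2_norm_eq_inner by (subst euclidean_inner) (simp add: grad_x_inner[OF d] power2_eq_square)
  show "weighted_grad_norm f z = 0" if "frechet_derivative f (at z) = (\<lambda>_. 0)"
    unfolding weighted_grad_norm_def sq partial_l_eq[OF d] that by simp
  show "continuous_on UNIV (weighted_grad_norm f)"
    unfolding weighted_grad_norm_def[abs_def] sq partial_l_eq[OF d]
    by (intro continuous_intros C0_infinity_props(3)[OF f])
qed

text \<open>The weight blows up only at \<open>\<bar>\<lambda>\<bar> = 1\<close>, which the compact support stays away from.\<close>

lemma integrable_weighted_compact_support:
  fixes g :: "(real ^ 'n) \<times> real \<Rightarrow> real"
  assumes S: "compact S" "S \<subseteq> cyl1" and g: "continuous_on UNIV g" "\<And>z. z \<notin> S \<Longrightarrow> g z = 0"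
  shows "(\<lambda>z. (1 - \<bar>snd z\<bar>) powr \<alpha> * g z) \<in> borel_measurable borel"
    "integrable lborel (\<lambda>z. (1 - \<bar>snd z\<bar>) powr \<alpha> * g z)"
    "\<exists>B. \<forall>z. \<bar>(1 - \<bar>snd z\<bar>) powr \<alpha> * g z\<bar> \<le> B"
proof -
  define F where "F z = (1 - \<bar>snd z\<bar>) powr \<alpha> * g z" for z :: "(real ^ 'n) \<times> real"
  have [measurable]: "g \<in> borel_measurable borel"
    using g(1) by (rule borel_measurable_continuous_onI)
  have [measurable]: "(snd :: (real ^ 'n) \<times> real \<Rightarrow> real) \<in> borel_measurable borel"
    by (intro borel_measurable_continuous_onI continuous_intros)
  show "(\<lambda>z. (1 - \<bar>snd z\<bar>) powr \<alpha> * g z) \<in> borel_measurable borel"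
    by measurable
  have F0: "F z = 0" if "z \<notin> S" for z
    using g(2)[OF that] by (simp add: F_def)
  have cont: "continuous_on S F"
    unfolding F_def using S(2) by (intro continuous_intros continuous_on_subset[OF g(1)]) (auto simp: cyl1_def)
  have "(\<lambda>z. indicator S z *\<^sub>R F z) = F"
  proof
    show "indicator S z *\<^sub>R F z = F z" for z
      using F0[of z] by (cases "z \<in> S") auto
  qed
  with borel_integrable_compact[OF S(1) cont] have "integrable lborel F"
    by (simp only:)
  then show "integrable lborel (\<lambda>z. (1 - \<bar>snd z\<bar>) powr \<alpha> * g z)"
    unfolding F_def .
  obtain B where B: "\<And>z. z \<in> S \<Longrightarrow> norm (F z) \<le> B"
    using compact_imp_bounded[OF compact_continuous_image[OF cont S(1)]] by (auto simp: bounded_iff)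
  have "\<bar>F z\<bar> \<le> max B 0" for z
    using B[of z] F0[of z] by (cases "z \<in> S") auto
  then show "\<exists>B. \<forall>z. \<bar>(1 - \<bar>snd z\<bar>) powr \<alpha> * g z\<bar> \<le> B"
    unfolding F_def by blast
qed

section \<open>Line integrals in the cylinder\<close>

lemma inner_Basis_less_1_if_cyl1:
  fixes z :: "(real ^ 'n) \<times> real"
  assumes "z \<in> cyl1" "b \<in> Basis"
  shows "\<bar>z \<bullet> b\<bar> < 1"
proof -
  obtain x l where z: "z = (x, l)" "norm x < 1" "\<bar>l\<bar> < 1"
    using assms(1) by (auto simp: cyl1_def)
  from assms(2) consider i where "i \<in> Basis" "b = (i, 0)" | "b = (0, 1)"
    by (auto simp: Basis_prod_def)
  then show ?thesis
  proof cases
    case 1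
    then show ?thesis using Basis_le_norm[of i x] z by simp
  qed (use z in simp)
qed

lemma cyl1_subset_cbox: "(cyl1 :: ((real ^ 'n) \<times> real) set) \<subseteq> cbox (-One) One"
proof
  fix z :: "(real ^ 'n) \<times> real" assume "z \<in> cyl1"
  then have "-1 \<le> z \<bullet> b \<and> z \<bullet> b \<le> 1" if "b \<in> Basis" for b
    using inner_Basis_less_1_if_cyl1[of z b] that by force
  then show "z \<in> cbox (-One) One" by (simp add: mem_box)
qed

text \<open>A point of the box leaves the cylinder after moving by the side length of the box along a coordinate
  axis. This provides the zero of \<open>f\<close> from which the fundamental theorem of calculus is applied.\<close>

lemma shift_notin_cyl1:
  fixes z :: "(real ^ 'n) \<times> real"
  assumes z: "z \<in> cbox (-One) One" and b: "b \<in> Basis" "v = b \<or> v = - b" and t: "2 \<le> \<bar>t\<bar>"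
  shows "z + t *\<^sub>R v \<notin> cyl1"
proof
  assume "z + t *\<^sub>R v \<in> cyl1"
  from inner_Basis_less_1_if_cyl1[OF this b(1)] have "\<bar>z \<bullet> b + t * (v \<bullet> b)\<bar> < 1"
    by (simp add: inner_add_left)
  moreover have "\<bar>z \<bullet> b\<bar> \<le> 1"
    using z b(1) by (auto simp: mem_box abs_le_iff)
  moreover have "\<bar>t * (v \<bullet> b)\<bar> = \<bar>t\<bar>"
    using b by auto
  ultimately show False using t by linarith
qed

text \<open>The direction \<open>v\<close> is a basis vector or its negative because the estimate in the \<open>\<lambda>\<close> direction has to
  run outwards from \<open>\<lambda> = 0\<close>, hence in different directions for the two signs of \<open>\<lambda>\<close>. The integral over
  a segment is at most the integral over the full line, which is the same for \<open>v\<close> and \<open>- v\<close>.\<close>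

context
  fixes H :: "(real ^ 'n) \<times> real \<Rightarrow> real" and B :: real and z b v :: "(real ^ 'n) \<times> real"
  assumes H: "H \<in> borel_measurable borel" "\<And>z. 0 \<le> H z \<and> H z \<le> B" "\<And>z. z \<notin> cyl1 \<Longrightarrow> H z = 0"
    and z: "z \<in> cbox (-One) One" and b: "b \<in> Basis" "v = b \<or> v = - b"
begin

lemma integrable_along_line: "integrable lborel (\<lambda>t. H (z + t *\<^sub>R v))"
proof (rule Bochner_Integration.integrable_bound)
  show "integrable lborel (\<lambda>t::real. B * indicator {-2..2} t)" by simp
  show "(\<lambda>t. H (z + t *\<^sub>R v)) \<in> borel_measurable lborel"
    using H(1) by simp
  have "norm (H (z + t *\<^sub>R v)) \<le> norm (B * indicator {-2..2} t)" for t :: real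
  proof (cases "2 \<le> \<bar>t\<bar>")
    case True
    then show ?thesis using H(3) shift_notin_cyl1[OF z b True] by simp
  next
    case False
    then have "t \<in> {-2..2}" by auto
    then show ?thesis using H(2)[of "z + t *\<^sub>R v"] by simp
  qed
  then show "AE t in lborel. norm (H (z + t *\<^sub>R v)) \<le> norm (B * indicator {-2..2} t)"
    by simp
qed

lemma segment_integral_le_line_integral: "(LBINT t:{0..2}. H (z + t *\<^sub>R v)) \<le> (\<integral>t. H (z + t *\<^sub>R b) \<partial>lborel)"
proof -
  have "(LBINT t:{0..2}. H (z + t *\<^sub>R v)) \<le> (\<integral>t. H (z + t *\<^sub>R v) \<partial>lborel)"
    unfolding set_lebesgue_integral_def
    by (rule integral_mono'[OF integrable_along_line]) (use H(2) in \<open>auto simp: indicator_def\<close>)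
  also have "\<dots> = (\<integral>t. H (z + t *\<^sub>R b) \<partial>lborel)"
    using b(2)
  proof
    assume "v = - b"
    then show ?thesis
      by (subst lborel_integral_real_affine[where c="-1" and t=0]) auto
  qed simp
  finally show ?thesis .
qed

text \<open>\<open>\<bar>f z\<bar> powr s\<close> is the increment of \<open>\<bar>f\<bar> powr s\<close> along the segment from \<open>z\<close> to a point where \<open>f\<close> vanishes.
  The constant \<open>c\<close> plays the part of the weight frozen at \<open>z\<close>.\<close>

lemma powr_le_line_integral:
  assumes f: "f \<in> C0_infinity cyl1" and s: "s > 1" and c: "0 \<le> c"
    and le: "\<And>t. 0 \<le> t \<Longrightarrow> z + t *\<^sub>R v \<in> cyl1 \<Longrightarrow> c * (s * \<bar>f (z + t *\<^sub>R v)\<bar> powr (s - 1) *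
       \<bar>frechet_derivative f (at (z + t *\<^sub>R v)) v\<bar>) \<le> H (z + t *\<^sub>R v)"
  shows "c * \<bar>f z\<bar> powr s \<le> (LBINT t:{0..2}. H (z + t *\<^sub>R v))"
proof -
  note fp = C0_infinity_props[OF f]
  have f0: "f y = 0" if "y \<notin> cyl1" for y
    using fp(4) that by blast
  define \<phi> where "\<phi> t = f (z + t *\<^sub>R v)" for t
  define \<phi>' where "\<phi>' t = frechet_derivative f (at (z + t *\<^sub>R v)) v" for t
  have d: "(\<phi> has_real_derivative \<phi>' t) (at t)" for t
  proof -
    let ?D = "frechet_derivative f (at (z + t *\<^sub>R v))"
    have "((\<lambda>t. z + t *\<^sub>R v) has_derivative (\<lambda>h. h *\<^sub>R v)) (at t)"
      by (auto intro!: derivative_eq_intros)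
    moreover have "(f has_derivative ?D) (at (z + t *\<^sub>R v))"
      using fp(1) frechet_derivative_works by blast
    ultimately have "((\<lambda>t. f (z + t *\<^sub>R v)) has_derivative (\<lambda>h. ?D (h *\<^sub>R v))) (at t)"
      using diff_chain_at[of "\<lambda>t. z + t *\<^sub>R v"] unfolding o_def by blast
    moreover have "(\<lambda>h. ?D (h *\<^sub>R v)) = (*) (?D v)"
    proof
      show "?D (h *\<^sub>R v) = ?D v * h" for h
        using linear_cmul[OF linear_frechet_derivative[OF fp(1)], of "z + t *\<^sub>R v" h v] by (simp add: mult.commute)
    qed
    ultimately show ?thesis
      unfolding has_field_derivative_def \<phi>_def[abs_def] \<phi>'_def by (simp only:)
  qed
  have c': "continuous_on UNIV \<phi>'"
    unfolding \<phi>'_def[abs_def]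
    by (rule continuous_on_compose2[OF fp(3)]) (auto intro!: continuous_intros)
  have "\<phi> 2 = 0"
    unfolding \<phi>_def by (rule f0, rule shift_notin_cyl1[OF z b]) simp
  then have "c * \<bar>f z\<bar> powr s \<le> c * (LBINT t:{0..2}. s * \<bar>\<phi> t\<bar> powr (s - 1) * \<bar>\<phi>' t\<bar>)"
    using abs_powr_increment_le[OF s _ d c', of 0 2] c by (intro mult_left_mono) (auto simp: \<phi>_def)
  also have "\<dots> = (LBINT t:{0..2}. c * (s * \<bar>\<phi> t\<bar> powr (s - 1) * \<bar>\<phi>' t\<bar>))"
    by simp
  also have "\<dots> \<le> (LBINT t:{0..2}. H (z + t *\<^sub>R v))"
    unfolding set_lebesgue_integral_def
  proof (rule integral_mono')
    show "integrable lborel (\<lambda>t. indicat_real {0..2} t *\<^sub>R H (z + t *\<^sub>R v))"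
      using integrable_along_line by (intro integrable_mult_indicator) auto
    fix t :: real
    show "0 \<le> indicat_real {0..2} t *\<^sub>R H (z + t *\<^sub>R v)"
      using H(2) by simp
    have "c * (s * \<bar>\<phi> t\<bar> powr (s - 1) * \<bar>\<phi>' t\<bar>) \<le> H (z + t *\<^sub>R v)" if "0 \<le> t"
    proof (cases "z + t *\<^sub>R v \<in> cyl1")
      case True
      then show ?thesis using le that by (simp add: \<phi>_def \<phi>'_def)
    next
      case False
      then show ?thesis using f0[OF False] H(2) by (simp add: \<phi>_def)
    qed
    then show "indicat_real {0..2} t *\<^sub>R (c * (s * \<bar>\<phi> t\<bar> powr (s - 1) * \<bar>\<phi>' t\<bar>))
        \<le> indicat_real {0..2} t *\<^sub>R H (z + t *\<^sub>R v)"
      by (auto simp: indicator_def)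
  qed
  finally show ?thesis .
qed

end

text \<open>The weight times \<open>s * \<bar>f\<bar> powr (s - 1) * \<bar>\<nabla>f\<bar> = \<bar>\<nabla>(\<bar>f\<bar> powr s)\<bar>\<close>, with the gradient measured by
  \<open>weighted_grad_norm\<close>.\<close>

definition power_gradient ::
  "real \<Rightarrow> real \<Rightarrow> ((real ^ 'n) \<times> real \<Rightarrow> real) \<Rightarrow> (real ^ 'n) \<times> real \<Rightarrow> real" where
  "power_gradient \<alpha> s f z = (1 - \<bar>snd z\<bar>) powr \<alpha> * (s * \<bar>f z\<bar> powr (s - 1) * weighted_grad_norm f z)"

lemma power_gradient_props:
  assumes f: "f \<in> C0_infinity cyl1" and s: "s > 1"
  shows "power_gradient \<alpha> s f \<in> borel_measurable borel"
    "integrable lborel (power_gradient \<alpha> s f)"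
    "0 \<le> power_gradient \<alpha> s f z"
    "\<exists>B. \<forall>z. 0 \<le> power_gradient \<alpha> s f z \<and> power_gradient \<alpha> s f z \<le> B"
    "z \<notin> cyl1 \<Longrightarrow> power_gradient \<alpha> s f z = 0"
proof -
  obtain S where S: "compact S" "S \<subseteq> cyl1" "\<And>z. z \<notin> S \<Longrightarrow> f z = 0"
    using C0_infinity_props(4)[OF f] by blast
  have "continuous_on UNIV (\<lambda>z. s * \<bar>f z\<bar> powr (s - 1) * weighted_grad_norm f z)"
    using s by (intro continuous_intros continuous_on_powr' C0_infinity_props(2)[OF f] weighted_grad_norm_props(5)[OF f]) auto
  note * = integrable_weighted_compact_support[OF S(1,2) this, of \<alpha>, folded power_gradient_def]
  have z: "s * \<bar>f z\<bar> powr (s - 1) * weighted_grad_norm f z = 0" if "z \<notin> S" for z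
    using S(3)[OF that] by simp
  show nn: "0 \<le> power_gradient \<alpha> s f z" for z
    using s weighted_grad_norm_props(1)[OF f] by (simp add: power_gradient_def)
  show "power_gradient \<alpha> s f \<in> borel_measurable borel" "integrable lborel (power_gradient \<alpha> s f)"
    using *(1,2)[OF z] by simp_all
  show "\<exists>B. \<forall>z. 0 \<le> power_gradient \<alpha> s f z \<and> power_gradient \<alpha> s f z \<le> B"
    using *(3)[OF z] nn by fastforce
  show "power_gradient \<alpha> s f z = 0" if "z \<notin> cyl1"
    using z[of z] S(2) that unfolding power_gradient_def by auto
qed

text \<open>The weight is constant along horizontal lines. The integral over the bounded segment is kept here since
  the Poincare inequality needs it; Gagliardo's inequality uses the whole line.\<close>

lemma horizontal_bound:
  fixes z :: "(real ^ 'n) \<times> real"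
  assumes f: "f \<in> C0_infinity cyl1" and s: "s > 1" and z: "z \<in> cbox (-One) One" and i: "i \<in> Basis"
  shows "(1 - \<bar>snd z\<bar>) powr \<alpha> * \<bar>f z\<bar> powr s \<le> (LBINT t:{0..2}. power_gradient \<alpha> s f (z + t *\<^sub>R (i, 0)))"
proof -
  obtain B where B: "\<And>z. 0 \<le> power_gradient \<alpha> s f z \<and> power_gradient \<alpha> s f z \<le> B"
    using power_gradient_props(4)[OF f s] by blast
  show ?thesis
  proof (rule powr_le_line_integral[OF power_gradient_props(1)[OF f s] B power_gradient_props(5)[OF f s] z _ _ f s])
    show "(i, 0::real) \<in> Basis" using i by (simp add: Basis_prod_def)
    fix t :: real
    show "(1 - \<bar>snd z\<bar>) powr \<alpha> * (s * \<bar>f (z + t *\<^sub>R (i, 0))\<bar> powr (s - 1) *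
        \<bar>frechet_derivative f (at (z + t *\<^sub>R (i, 0))) (i, 0)\<bar>) \<le> power_gradient \<alpha> s f (z + t *\<^sub>R (i, 0))"
      unfolding power_gradient_def
      using s i weighted_grad_norm_props(2)[OF f, of i "z + t *\<^sub>R (i, 0)"]
      by (auto intro!: mult_left_mono)
  qed auto
qed

text \<open>Moving outwards, \<open>(1 - \<bar>\<lambda>\<bar>) powr (\<alpha> + 1)\<close> does not decrease since \<open>\<alpha> + 1 \<le> 0\<close>, so its value at \<open>z\<close> may
  be moved under the integral. One power of \<open>1 - \<bar>\<lambda>\<bar>\<close> is spent on the factor of \<open>\<partial>\<^sub>\<lambda> f\<close> in
  \<open>weighted_grad_norm\<close>; this is why the exponent is \<open>\<alpha> + 1\<close> and not \<open>\<alpha>\<close>.\<close>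

lemma vertical_bound:
  fixes z :: "(real ^ 'n) \<times> real"
  assumes f: "f \<in> C0_infinity cyl1" and s: "s > 1" and z: "z \<in> cbox (-One) One" and \<alpha>: "\<alpha> \<le> -1"
  shows "(1 - \<bar>snd z\<bar>) powr (\<alpha> + 1) * \<bar>f z\<bar> powr s \<le> (\<integral>t. power_gradient \<alpha> s f (z + t *\<^sub>R (0, 1)) \<partial>lborel)"
proof -
  obtain B where B: "\<And>z. 0 \<le> power_gradient \<alpha> s f z \<and> power_gradient \<alpha> s f z \<le> B"
    using power_gradient_props(4)[OF f s] by blast
  define v :: "(real ^ 'n) \<times> real" where "v = (0, if 0 \<le> snd z then 1 else -1)"
  have b: "(0, 1) \<in> (Basis :: ((real ^ 'n) \<times> real) set)" "v = (0, 1) \<or> v = - (0, 1)"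
    by (auto simp: Basis_prod_def v_def)
  note H = power_gradient_props(1)[OF f s] B power_gradient_props(5)[OF f s]
  have "(1 - \<bar>snd z\<bar>) powr (\<alpha> + 1) * \<bar>f z\<bar> powr s \<le> (LBINT t:{0..2}. power_gradient \<alpha> s f (z + t *\<^sub>R v))"
  proof (rule powr_le_line_integral[OF H z b f s])
    fix t :: real assume t: "0 \<le> t" and cyl: "z + t *\<^sub>R v \<in> cyl1"
    define y where "y = z + t *\<^sub>R v"
    have y: "\<bar>snd y\<bar> < 1" "\<bar>snd z\<bar> \<le> \<bar>snd y\<bar>"
    proof -
      show "\<bar>snd y\<bar> < 1"
        using cyl unfolding y_def[symmetric] by (auto simp: cyl1_def)
      show "\<bar>snd z\<bar> \<le> \<bar>snd y\<bar>"
        using t by (auto simp: y_def v_def)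
    qed
    have D: "\<bar>frechet_derivative f (at y) v\<bar> = \<bar>frechet_derivative f (at y) (0, 1)\<bar>"
      using b(2) linear_neg[OF linear_frechet_derivative[OF C0_infinity_props(1)[OF f]], of y "(0, 1)"] by auto
    have "(1 - \<bar>snd z\<bar>) powr (\<alpha> + 1) \<le> (1 - \<bar>snd y\<bar>) powr (\<alpha> + 1)"
      using y \<alpha> by (intro powr_mono2') auto
    also have "\<dots> = (1 - \<bar>snd y\<bar>) powr \<alpha> * (1 - \<bar>snd y\<bar>)"
      using y by (simp add: powr_add)
    finally have "(1 - \<bar>snd z\<bar>) powr (\<alpha> + 1) * (s * \<bar>f y\<bar> powr (s - 1) * \<bar>frechet_derivative f (at y) v\<bar>)
      \<le> ((1 - \<bar>snd y\<bar>) powr \<alpha> * (1 - \<bar>snd y\<bar>)) * (s * \<bar>f y\<bar> powr (s - 1) * \<bar>frechet_derivative f (at y) (0, 1)\<bar>)"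
      unfolding D using s by (intro mult_right_mono) auto
    also have "\<dots> = (1 - \<bar>snd y\<bar>) powr \<alpha> * (s * \<bar>f y\<bar> powr (s - 1) * ((1 - \<bar>snd y\<bar>) * \<bar>frechet_derivative f (at y) (0, 1)\<bar>))"
      by simp
    also have "\<dots> \<le> power_gradient \<alpha> s f y"
      unfolding power_gradient_def using s weighted_grad_norm_props(3)[OF f, of y]
      by (intro mult_left_mono) auto
    finally show "(1 - \<bar>snd z\<bar>) powr (\<alpha> + 1) * (s * \<bar>f (z + t *\<^sub>R v)\<bar> powr (s - 1) *
        \<bar>frechet_derivative f (at (z + t *\<^sub>R v)) v\<bar>) \<le> power_gradient \<alpha> s f (z + t *\<^sub>R v)"
      unfolding y_def .
  qed (assumption, rule powr_ge_zero)
  also have "\<dots> \<le> (\<integral>t. power_gradient \<alpha> s f (z + t *\<^sub>R (0, 1)) \<partial>lborel)"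
    by (rule segment_integral_le_line_integral[OF H z b])
  finally show ?thesis .
qed

section \<open>Weighted Poincare and Sobolev inequalities\<close>

definition weighted_mass :: "real \<Rightarrow> real \<Rightarrow> ((real ^ 'n) \<times> real \<Rightarrow> real) \<Rightarrow> real" where
  "weighted_mass \<alpha> p f = (\<integral>z. (1 - \<bar>snd z\<bar>) powr \<alpha> * \<bar>f z\<bar> powr p \<partial>lborel)"

definition weighted_energy :: "real \<Rightarrow> ((real ^ 'n) \<times> real \<Rightarrow> real) \<Rightarrow> real" where
  "weighted_energy \<alpha> f = (\<integral>z. (1 - \<bar>snd z\<bar>) powr \<alpha> * (weighted_grad_norm f z)\<^sup>2 \<partial>lborel)"

lemma weighted_mass_nonneg: "0 \<le> weighted_mass \<alpha> p f"
  unfolding weighted_mass_def by (rule Bochner_Integration.integral_nonneg) simp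

lemma weighted_energy_nonneg: "0 \<le> weighted_energy \<alpha> f"
  unfolding weighted_energy_def by (rule Bochner_Integration.integral_nonneg) simp

lemma integrable_weighted_mass:
  assumes f: "f \<in> C0_infinity cyl1" and p: "p > 0"
  shows "integrable lborel (\<lambda>z. (1 - \<bar>snd z\<bar>) powr \<alpha> * \<bar>f z\<bar> powr p)"
proof -
  obtain S where S: "compact S" "S \<subseteq> cyl1" "\<And>z. z \<notin> S \<Longrightarrow> f z = 0"
    using C0_infinity_props(4)[OF f] by blast
  have "continuous_on UNIV (\<lambda>z. \<bar>f z\<bar> powr p)"
    using p by (intro continuous_intros continuous_on_powr' C0_infinity_props(2)[OF f]) auto
  then show ?thesis
    using integrable_weighted_compact_support(2)[OF S(1,2)] S(3) by simp
qed

lemma integrable_weighted_energy: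
  assumes f: "f \<in> C0_infinity cyl1"
  shows "integrable lborel (\<lambda>z. (1 - \<bar>snd z\<bar>) powr \<alpha> * (weighted_grad_norm f z)\<^sup>2)"
proof -
  obtain S where S: "compact S" "S \<subseteq> cyl1" "\<And>z. z \<notin> S \<Longrightarrow> frechet_derivative f (at z) = (\<lambda>_. 0)"
    using C0_infinity_props(4)[OF f] by blast
  show ?thesis
    using weighted_grad_norm_props(4)[OF f S(3)]
    by (intro integrable_weighted_compact_support(2)[OF S(1,2)] continuous_intros weighted_grad_norm_props(5)[OF f]) simp
qed

text \<open>Cauchy--Schwarz, with the weight split evenly between \<open>\<bar>f\<bar> powr (s - 1)\<close> and the gradient.\<close>

lemma integral_power_gradient_le:
  assumes f: "f \<in> C0_infinity cyl1" and s: "s > 1"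
  shows "(\<integral>z. power_gradient \<alpha> s f z \<partial>lborel)
    \<le> s * sqrt (weighted_mass \<alpha> (2 * (s - 1)) f * weighted_energy \<alpha> f)"
proof -
  define g where "g c z = (1 - \<bar>snd z\<bar>) powr \<alpha> *
     (if c then \<bar>f z\<bar> powr (2 * (s - 1)) else (weighted_grad_norm f z)\<^sup>2)" for c z
  have split: "power_gradient \<alpha> s f z = s * (\<Prod>c\<in>UNIV. g c z powr (1 / 2))" for z
  proof -
    let ?W = "(1 - \<bar>snd z\<bar>) powr \<alpha>"
    have G: "sqrt ((weighted_grad_norm f z)\<^sup>2) = weighted_grad_norm f z"
      using weighted_grad_norm_props(1)[OF f, of z] by simp
    have "2 * (s - 1) * (1 / 2) = s - 1" by simp
    then have F: "sqrt (\<bar>f z\<bar> powr (2 * (s - 1))) = \<bar>f z\<bar> powr (s - 1)"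
      by (simp only: powr_half_sqrt[symmetric, OF powr_ge_zero] powr_powr)
    have "(\<Prod>c\<in>UNIV. g c z powr (1 / 2)) = sqrt (g False z) * sqrt (g True z)"
      by (simp add: UNIV_bool powr_half_sqrt g_def)
    also have "\<dots> = (sqrt ?W * weighted_grad_norm f z) * (sqrt ?W * \<bar>f z\<bar> powr (s - 1))"
      unfolding g_def by (simp only: real_sqrt_mult G F if_True if_False)
    also have "\<dots> = (sqrt ?W * sqrt ?W) * (\<bar>f z\<bar> powr (s - 1) * weighted_grad_norm f z)"
      by (simp only: mult_ac)
    also have "sqrt ?W * sqrt ?W = ?W" by simp
    finally show ?thesis by (simp add: power_gradient_def)
  qed
  have "(\<integral>z. (\<Prod>c\<in>UNIV. g c z powr (1 / 2)) \<partial>lborel) \<le> (\<Prod>c\<in>UNIV. (\<integral>z. g c z \<partial>lborel) powr (1 / 2))"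
  proof (rule Holder_integral_prod)
    show "integrable lborel (g c)" for c
      using integrable_weighted_mass[OF f, of "2 * (s - 1)" \<alpha>] integrable_weighted_energy[OF f, of \<alpha>] s
      by (cases c) (simp_all add: g_def[abs_def])
  qed (auto simp: g_def UNIV_bool)
  also have "\<dots> = sqrt (weighted_mass \<alpha> (2 * (s - 1)) f * weighted_energy \<alpha> f)"
    using weighted_mass_nonneg[of \<alpha> "2 * (s - 1)" f] weighted_energy_nonneg[of \<alpha> f]
    by (simp add: g_def UNIV_bool weighted_mass_def weighted_energy_def real_sqrt_mult powr_half_sqrt)
  finally show ?thesis
    unfolding split using s by simp
qed

text \<open>By \<open>horizontal_bound\<close> with \<open>s = 2\<close>, the integrand \<open>\<rho> powr \<alpha> * f\<^sup>2\<close> is at most the integral of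
  \<open>power_gradient \<alpha> 2 f\<close> over the translates by \<open>t \<in> {0..2}\<close> in one horizontal direction. Integrating over
  space first, translation invariance gives twice the integral of \<open>power_gradient \<alpha> 2 f\<close>, and
  \<open>integral_power_gradient_le\<close> leaves \<open>m \<le> 4 * sqrt (m * K)\<close>.\<close>

lemma weighted_poincare:
  fixes f :: "(real ^ 'n) \<times> real \<Rightarrow> real"
  assumes f: "f \<in> C0_infinity cyl1"
  shows "weighted_mass \<alpha> 2 f \<le> 16 * weighted_energy \<alpha> f"
proof -
  define w where "w z = (1 - \<bar>snd z\<bar>) powr \<alpha> * \<bar>f z\<bar> powr 2" for z
  define H where "H = power_gradient \<alpha> 2 f"
  have H: "H \<in> borel_measurable borel" "integrable lborel H" "\<And>z. 0 \<le> H z" "\<And>z. z \<notin> cyl1 \<Longrightarrow> H z = 0"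
    and "\<exists>B. \<forall>z. 0 \<le> H z \<and> H z \<le> B"
    unfolding H_def using power_gradient_props[OF f, of 2] by auto
  then obtain B where B: "\<And>z. 0 \<le> H z \<and> H z \<le> B" by blast
  note [measurable] = H(1)
  obtain i :: "real ^ 'n" where i: "i \<in> Basis" using nonempty_Basis by blast
  define b where "b = (i, 0::real)"
  have b: "b \<in> Basis" "b = b \<or> b = - b" using i by (auto simp: b_def Basis_prod_def)
  have "ennreal (w z) \<le> (\<integral>\<^sup>+t. indicator {0..2} t * ennreal (H (z + t *\<^sub>R b)) \<partial>lborel)" for z
  proof (cases "z \<in> cyl1")
    case True
    then have z: "z \<in> cbox (-One) One" using cyl1_subset_cbox by auto
    have int: "integrable lborel (\<lambda>t. indicat_real {0..2} t *\<^sub>R H (z + t *\<^sub>R b))"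
      by (intro integrable_mult_indicator integrable_along_line[OF H(1) B H(4) z b]) auto
    have "ennreal (w z) \<le> ennreal (LBINT t:{0..2}. H (z + t *\<^sub>R b))"
      using horizontal_bound[OF f _ z i, of 2 \<alpha>] by (intro ennreal_leI) (simp add: w_def H_def b_def)
    also have "\<dots> = (\<integral>\<^sup>+t. ennreal (indicat_real {0..2} t *\<^sub>R H (z + t *\<^sub>R b)) \<partial>lborel)"
      unfolding set_lebesgue_integral_def
      using nn_integral_eq_integral[OF int] H(3) by simp
    also have "\<dots> = (\<integral>\<^sup>+t. indicator {0..2} t * ennreal (H (z + t *\<^sub>R b)) \<partial>lborel)"
      by (simp add: ennreal_mult' ennreal_indicator)
    finally show ?thesis .
  next
    case False
    then show ?thesis
      using C0_infinity_eq_0[OF f] by (simp add: w_def)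
  qed
  then have "(\<integral>\<^sup>+z. ennreal (w z) \<partial>lborel) \<le> (\<integral>\<^sup>+z. (\<integral>\<^sup>+t. indicator {0..2} t * ennreal (H (z + t *\<^sub>R b)) \<partial>lborel) \<partial>lborel)"
    by (intro nn_integral_mono)
  also have "\<dots> = (\<integral>\<^sup>+t. (\<integral>\<^sup>+z. indicator {0..2} t * ennreal (H (z + t *\<^sub>R b)) \<partial>lborel) \<partial>lborel)"
    by (intro lborel_pair.Fubini'[symmetric]) simp
  also have "\<dots> = (\<integral>\<^sup>+t. indicator {0..2::real} t * (\<integral>\<^sup>+z. ennreal (H z) \<partial>lborel) \<partial>lborel)"
  proof (rule nn_integral_cong)
    fix t :: real
    have "(\<integral>\<^sup>+z. ennreal (H (z + t *\<^sub>R b)) \<partial>lborel) = (\<integral>\<^sup>+z. ennreal (H z) \<partial>distr lborel borel ((+) (t *\<^sub>R b)))"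
      by (simp add: nn_integral_distr add.commute)
    then show "(\<integral>\<^sup>+z. indicator {0..2} t * ennreal (H (z + t *\<^sub>R b)) \<partial>lborel)
      = indicator {0..2} t * (\<integral>\<^sup>+z. ennreal (H z) \<partial>lborel)"
      by (simp add: nn_integral_cmult lborel_distr_plus)
  qed
  also have "\<dots> = ennreal (2 * (\<integral>z. H z \<partial>lborel))"
    using H(2,3) by (simp add: nn_integral_multc nn_integral_eq_integral ennreal_mult)
  also have "(\<integral>\<^sup>+z. ennreal (w z) \<partial>lborel) = ennreal (weighted_mass \<alpha> 2 f)"
    using integrable_weighted_mass[OF f, of 2 \<alpha>]
    by (simp add: w_def weighted_mass_def nn_integral_eq_integral)
  finally have "weighted_mass \<alpha> 2 f \<le> 2 * (\<integral>z. H z \<partial>lborel)"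
    using H(3) by (simp add: ennreal_le_iff)
  also have "\<dots> \<le> 4 * sqrt (weighted_mass \<alpha> 2 f * weighted_energy \<alpha> f)"
    using integral_power_gradient_le[OF f, of 2 \<alpha>] by (simp add: H_def)
  finally have "(weighted_mass \<alpha> 2 f)\<^sup>2 \<le> (4 * sqrt (weighted_mass \<alpha> 2 f * weighted_energy \<alpha> f))\<^sup>2"
    using weighted_mass_nonneg by (intro power_mono)
  then have "weighted_mass \<alpha> 2 f * weighted_mass \<alpha> 2 f \<le> weighted_mass \<alpha> 2 f * (16 * weighted_energy \<alpha> f)"
    using weighted_mass_nonneg[of \<alpha> 2 f] weighted_energy_nonneg[of \<alpha> f]
    by (simp add: power_mult_distrib power2_eq_square mult_ac)
  then show ?thesis
    using weighted_mass_nonneg[of \<alpha> 2 f] weighted_energy_nonneg[of \<alpha> f]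
    by (cases "weighted_mass \<alpha> 2 f = 0") (auto simp: mult_le_cancel_left)
qed

text \<open>With \<open>q = 1 / n\<close>, the \<open>n\<close> horizontal bounds contribute \<open>\<rho> powr \<alpha> * \<bar>f\<bar> powr s\<close> and the vertical one
  \<open>\<rho> powr (q * (\<alpha> + 1)) * \<bar>f\<bar> powr (q * s)\<close> to the product in \<open>gagliardo_lborel\<close>. The first factor of the
  latter is at least one since \<open>\<rho> \<le> 1\<close> and \<open>\<alpha> + 1 \<le> 0\<close>.\<close>

lemma weighted_sobolev_step:
  fixes f :: "(real ^ 'n) \<times> real \<Rightarrow> real"
  assumes f: "f \<in> C0_infinity cyl1" and s: "s > 1" and \<alpha>: "\<alpha> \<le> -1"
  shows "weighted_mass \<alpha> (s * (1 + 1 / CARD('n))) f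
    \<le> (s * sqrt (weighted_mass \<alpha> (2 * (s - 1)) f * weighted_energy \<alpha> f)) powr (1 + 1 / CARD('n))"
proof -
  define q where "q = 1 / real CARD('n)"
  have q: "q > 0" "real CARD('n) * q = 1" by (simp_all add: q_def)
  define H where "H = power_gradient \<alpha> s f"
  define w where "w z = (1 - \<bar>snd z\<bar>) powr \<alpha> * \<bar>f z\<bar> powr (s * (1 + q))" for z
  have H: "H \<in> borel_measurable borel" "\<And>z. 0 \<le> H z" "\<And>z. z \<notin> cyl1 \<Longrightarrow> H z = 0"
    and "\<exists>B. \<forall>z. 0 \<le> H z \<and> H z \<le> B"
    unfolding H_def using power_gradient_props[OF f s] by auto
  then obtain B where B: "\<And>z. 0 \<le> H z \<and> H z \<le> B" by blast
  have dim: "real DIM((real ^ 'n) \<times> real) - 1 = CARD('n)" "real DIM((real ^ 'n) \<times> real) = CARD('n) + 1" by auto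
  have w0: "w z = 0" if "z \<notin> cbox (-One) One" for z
  proof -
    have "f z = 0"
      using C0_infinity_eq_0[OF f] that cyl1_subset_cbox by blast
    then show ?thesis by (simp add: w_def)
  qed
  have le: "w z \<le> (\<Prod>b\<in>Basis. (\<integral>t. H (z + t *\<^sub>R b) \<partial>lborel) powr q)" if z: "z \<in> cbox (-One) One" for z
  proof -
    define J where "J b = (\<integral>t. H (z + t *\<^sub>R b) \<partial>lborel)" for b
    define r where "r = 1 - \<bar>snd z\<bar>"
    have "(0, 1) \<in> (Basis :: ((real ^ 'n) \<times> real) set)" by (simp add: Basis_prod_def)
    then have "\<bar>z \<bullet> (0, 1)\<bar> \<le> 1" using z by (auto simp: mem_box abs_le_iff)
    then have r: "0 \<le> r" "r \<le> 1" by (auto simp: r_def inner_prod_def)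
    have hor: "r powr \<alpha> * \<bar>f z\<bar> powr s \<le> J (i, 0)" if "i \<in> Basis" for i
    proof -
      have b: "(i, 0) \<in> (Basis :: ((real ^ 'n) \<times> real) set)" "(i, 0::real) = (i, 0) \<or> (i, 0::real) = - (i, 0)"
        using that by (auto simp: Basis_prod_def)
      have "(LBINT t:{0..2}. H (z + t *\<^sub>R (i, 0))) \<le> J (i, 0)"
        unfolding J_def by (rule segment_integral_le_line_integral[OF H(1) B H(3) z b])
      with horizontal_bound[OF f s z that, of \<alpha>] show ?thesis
        unfolding r_def H_def by (rule order_trans)
    qed
    have ver: "r powr (\<alpha> + 1) * \<bar>f z\<bar> powr s \<le> J (0, 1)"
      unfolding r_def J_def H_def by (rule vertical_bound[OF f s z \<alpha>])
    have "(\<Prod>b\<in>Basis. J b powr q) = (\<Prod>i\<in>(Basis :: (real ^ 'n) set). J (i, 0) powr q) * J (0, 1) powr q"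
      unfolding Basis_prod_def
      by (subst prod.union_disjoint) (auto simp: prod.reindex inj_on_def)
    also have "\<dots> \<ge> (\<Prod>i\<in>(Basis :: (real ^ 'n) set). (r powr \<alpha> * \<bar>f z\<bar> powr s) powr q) * (r powr (\<alpha> + 1) * \<bar>f z\<bar> powr s) powr q"
      using hor ver q by (intro mult_mono prod_mono prod_nonneg conjI powr_mono2) auto
    also have "(\<Prod>i\<in>(Basis :: (real ^ 'n) set). (r powr \<alpha> * \<bar>f z\<bar> powr s) powr q) = r powr \<alpha> * \<bar>f z\<bar> powr s"
      using q by (simp add: powr_realpow'[symmetric] powr_powr mult.commute[of q])
    also have "(r powr \<alpha> * \<bar>f z\<bar> powr s) * (r powr (\<alpha> + 1) * \<bar>f z\<bar> powr s) powr q
       = r powr (q * (\<alpha> + 1)) * (r powr \<alpha> * (\<bar>f z\<bar> powr (s + q * s)))"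
    proof -
      have "\<bar>f z\<bar> powr (s + q * s) = \<bar>f z\<bar> powr s * \<bar>f z\<bar> powr (q * s)"
        by (rule powr_add)
      moreover have "(r powr (\<alpha> + 1) * \<bar>f z\<bar> powr s) powr q = r powr (q * (\<alpha> + 1)) * \<bar>f z\<bar> powr (q * s)"
        by (simp add: powr_mult powr_powr mult.commute[of q])
      ultimately show ?thesis by simp
    qed
    also have "\<dots> \<ge> w z"
    proof (cases "r = 0")
      case False
      \<comment> \<open>At \<open>r = 0\<close> both sides vanish by the convention for \<open>0 powr\<close>; elsewhere the surplus power of \<open>r\<close> is at least one.\<close>
      have "1 powr (q * (\<alpha> + 1)) \<le> r powr (q * (\<alpha> + 1))"
        using r False q \<alpha> by (intro powr_mono2') (auto simp: mult_nonneg_nonpos)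
      then have "1 * (r powr \<alpha> * (\<bar>f z\<bar> powr (s + q * s))) \<le> r powr (q * (\<alpha> + 1)) * (r powr \<alpha> * (\<bar>f z\<bar> powr (s + q * s)))"
        by (intro mult_right_mono) auto
      then show ?thesis by (simp add: w_def r_def[symmetric] algebra_simps)
    qed (simp add: w_def r_def)
    finally show ?thesis by (simp add: J_def)
  qed
  have "(\<integral>z. w z \<partial>lborel)
      \<le> (\<integral>z. H z \<partial>lborel) powr (real DIM((real ^ 'n) \<times> real) / (real DIM((real ^ 'n) \<times> real) - 1))"
  proof (rule gagliardo_lborel[OF _ H(1) B _ _ w0])
    show "DIM((real ^ 'n) \<times> real) \<ge> 2"
      using zero_less_card_finite[where 'a='n] by simp
    show "H z = 0" if "z \<notin> cbox (-One) One" for z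
      using H(3) that cyl1_subset_cbox by blast
    show "w \<in> borel_measurable borel"
      using borel_measurable_integrable[OF integrable_weighted_mass[OF f, of "s * (1 + q)" \<alpha>]] s q
      by (simp add: w_def[abs_def])
    show "w z \<le> (\<Prod>b\<in>Basis. (\<integral>t. H (z + t *\<^sub>R b) \<partial>lborel) powr (1 / (real DIM((real ^ 'n) \<times> real) - 1)))"
      if "z \<in> cbox (-One) One" for z
      unfolding dim(1) q_def[symmetric] by (rule le[OF that])
  qed
  also have "real DIM((real ^ 'n) \<times> real) / (real DIM((real ^ 'n) \<times> real) - 1) = 1 + q"
    unfolding dim by (simp add: q_def field_simps)
  also have "(\<integral>z. H z \<partial>lborel) powr (1 + q) \<le> (s * sqrt (weighted_mass \<alpha> (2 * (s - 1)) f * weighted_energy \<alpha> f)) powr (1 + q)"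
    using integral_power_gradient_le[OF f s, of \<alpha>] q H(2)
    by (intro powr_mono2) (auto simp: H_def intro!: Bochner_Integration.integral_nonneg)
  finally show ?thesis by (simp add: w_def weighted_mass_def q_def)
qed

section \<open>From the recursion to all admissible exponents\<close>

lemma le_powr_absorb:
  fixes m k \<beta> :: real
  assumes "0 \<le> m" "0 \<le> k" "0 < \<beta>" "\<beta> < 1" and le: "m \<le> (m * k) powr \<beta>"
  shows "m \<le> k powr (\<beta> / (1 - \<beta>))"
proof (cases "m = 0")
  case False
  with assms have m: "0 < m" by simp
  have "m powr \<beta> * m powr (1 - \<beta>) = m"
    using m by (simp add: powr_add[symmetric])
  with le have "m powr \<beta> * m powr (1 - \<beta>) \<le> m powr \<beta> * k powr \<beta>"
    using assms by (simp add: powr_mult)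
  then have "m powr (1 - \<beta>) \<le> k powr \<beta>"
    using m by simp
  then have "(m powr (1 - \<beta>)) powr (1 / (1 - \<beta>)) \<le> (k powr \<beta>) powr (1 / (1 - \<beta>))"
    using assms by (intro powr_mono2) auto
  then show ?thesis using m assms by (simp add: powr_powr)
qed simp

text \<open>For \<open>s = P / 2 + 1\<close> the exponent \<open>2 (s - 1)\<close> on the right of \<open>weighted_sobolev_step\<close> is \<open>P\<close>, and the
  critical \<open>P\<close> is the one for which the exponent \<open>s (1 + 1 / n)\<close> on the left is \<open>P\<close> as well. Then \<open>m P\<close> occurs on
  the right to the power \<open>(n + 1) / (2 n) < 1\<close> and is absorbed.\<close>

lemma weighted_sobolev_critical:
  fixes f :: "(real ^ 'n) \<times> real \<Rightarrow> real"
  assumes f: "f \<in> C0_infinity cyl1" and \<alpha>: "\<alpha> \<le> -1" and n: "CARD('n) \<ge> 2"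
    and P: "P = 2 * (real CARD('n) + 1) / (real CARD('n) - 1)"
  shows "weighted_mass \<alpha> P f \<le> ((P / 2 + 1)\<^sup>2) powr (P / 2) * weighted_energy \<alpha> f powr (P / 2)"
proof -
  define n where "n = real CARD('n)"
  have n: "n \<ge> 2" using n by (simp add: n_def)
  have P: "P = 2 * (n + 1) / (n - 1)" using P by (simp add: n_def)
  define s where "s = P / 2 + 1"
  define \<beta> where "\<beta> = (1 + 1 / n) / 2"
  define K where "K = weighted_energy \<alpha> f"
  define m where "m = weighted_mass \<alpha> P f"
  have K: "0 \<le> K" and m: "0 \<le> m"
    by (simp_all add: K_def m_def weighted_energy_nonneg weighted_mass_nonneg)
  have "P > 2" using n by (simp add: P field_simps)
  then have s: "s > 1" by (simp add: s_def)
  have exps: "s * (1 + 1 / n) = P" "2 * (s - 1) = P"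
    using n by (simp_all add: s_def P field_simps)
  have "m \<le> (s * sqrt (m * K)) powr (1 + 1 / n)"
    using weighted_sobolev_step[OF f s \<alpha>, folded n_def] unfolding exps m_def K_def .
  also have "s * sqrt (m * K) = (m * (s\<^sup>2 * K)) powr (1 / 2)"
    using s m K by (simp add: powr_half_sqrt real_sqrt_mult)
  also have "\<dots> powr (1 + 1 / n) = (m * (s\<^sup>2 * K)) powr \<beta>"
    by (simp add: powr_powr \<beta>_def)
  finally have "m \<le> (s\<^sup>2 * K) powr (\<beta> / (1 - \<beta>))"
    using m K n by (intro le_powr_absorb) (auto simp: \<beta>_def field_simps)
  also have "\<beta> / (1 - \<beta>) = P / 2"
    using n by (simp add: \<beta>_def P field_simps)
  finally show ?thesis using K by (simp add: m_def K_def s_def powr_mult)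
qed

text \<open>For a single \<open>x\<close> variable the recursion raises the exponent from \<open>2 (s - 1)\<close> to \<open>2 s\<close>, so it climbs through
  the even integers instead of closing up.\<close>

lemma weighted_sobolev_even_exponent:
  assumes n: "CARD('n) = 1" and \<alpha>: "\<alpha> \<le> -1" and k: "k \<ge> 1"
  shows "\<exists>C\<ge>0. \<forall>f \<in> C0_infinity (cyl1 :: ((real ^ 'n) \<times> real) set).
    weighted_mass \<alpha> (2 * real k) f \<le> C * weighted_energy \<alpha> f ^ k"
  using k
proof (induction k rule: dec_induct)
  case base
  have "weighted_mass \<alpha> (2 * real 1) f \<le> 16 * weighted_energy \<alpha> f ^ 1"
    if "f \<in> C0_infinity cyl1" for f :: "(real ^ 'n) \<times> real \<Rightarrow> real"
    using weighted_poincare[OF that, of \<alpha>] by simp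
  then show ?case by (intro exI[of _ 16] conjI ballI) simp_all
next
  case (step k)
  then obtain C where C: "C \<ge> 0" "\<And>f :: (real ^ 'n) \<times> real \<Rightarrow> real. f \<in> C0_infinity cyl1 \<Longrightarrow>
      weighted_mass \<alpha> (2 * real k) f \<le> C * weighted_energy \<alpha> f ^ k"
    by blast
  have "weighted_mass \<alpha> (2 * real (Suc k)) f \<le> (real (Suc k))\<^sup>2 * C * weighted_energy \<alpha> f ^ Suc k"
    if f: "f \<in> C0_infinity cyl1" for f :: "(real ^ 'n) \<times> real \<Rightarrow> real"
  proof -
    let ?m = "weighted_mass \<alpha> (2 * real k) f" and ?K = "weighted_energy \<alpha> f"
    have nn: "0 \<le> ?m" "0 \<le> ?K" by (rule weighted_mass_nonneg weighted_energy_nonneg)+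
    have "weighted_mass \<alpha> (2 * real (Suc k)) f \<le> (real (Suc k) * sqrt (?m * ?K)) powr 2"
      using weighted_sobolev_step[OF f _ \<alpha>, of "real (Suc k)"] \<open>1 \<le> k\<close> by (simp add: n mult.commute)
    also have "\<dots> = (real (Suc k))\<^sup>2 * (?m * ?K)"
      using nn by (simp add: power_mult_distrib)
    also have "\<dots> \<le> (real (Suc k))\<^sup>2 * ((C * ?K ^ k) * ?K)"
      using C(2)[OF f] nn by (intro mult_left_mono mult_right_mono) auto
    finally show ?thesis by (simp add: mult_ac)
  qed
  then show ?case using C(1) by (intro exI[of _ "(real (Suc k))\<^sup>2 * C"]) simp
qed

lemma weighted_sobolev_large_exponent:
  assumes \<alpha>: "\<alpha> \<le> -1" and Q: "2 \<le> Q"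
    and Qle: "CARD('n) \<ge> 2 \<Longrightarrow> Q \<le> 2 * (real CARD('n) + 1) / (real CARD('n) - 1)"
  shows "\<exists>P\<ge>Q. \<exists>C\<ge>0. \<forall>f \<in> C0_infinity (cyl1 :: ((real ^ 'n) \<times> real) set).
    weighted_mass \<alpha> P f \<le> C * weighted_energy \<alpha> f powr (P / 2)"
proof (cases "CARD('n) \<ge> 2")
  case True
  define P where "P = 2 * (real CARD('n) + 1) / (real CARD('n) - 1)"
  have "Q \<le> P" "0 \<le> ((P / 2 + 1)\<^sup>2) powr (P / 2)"
    using Qle[OF True] by (simp_all add: P_def)
  moreover have "\<forall>f \<in> C0_infinity (cyl1 :: ((real ^ 'n) \<times> real) set).
    weighted_mass \<alpha> P f \<le> ((P / 2 + 1)\<^sup>2) powr (P / 2) * weighted_energy \<alpha> f powr (P / 2)"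
    using weighted_sobolev_critical[OF _ \<alpha> True P_def] by blast
  ultimately show ?thesis by blast
next
  case False
  then have n: "CARD('n) = 1"
    using zero_less_card_finite[where 'a='n] by linarith
  define k where "k = nat \<lceil>Q\<rceil>"
  have k: "k \<ge> 1" "Q \<le> 2 * real k" using Q by (auto simp: k_def) linarith+
  obtain C where C: "C \<ge> 0" "\<And>f :: (real ^ 'n) \<times> real \<Rightarrow> real. f \<in> C0_infinity cyl1 \<Longrightarrow>
      weighted_mass \<alpha> (2 * real k) f \<le> C * weighted_energy \<alpha> f ^ k"
    using weighted_sobolev_even_exponent[OF n \<alpha> k(1)] by blast
  have "weighted_energy \<alpha> f ^ k = weighted_energy \<alpha> f powr (2 * real k / 2)" for f :: "(real ^ 'n) \<times> real \<Rightarrow> real"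
    using k(1) weighted_energy_nonneg[of \<alpha> f] by (simp add: powr_realpow')
  with C have "\<forall>f \<in> C0_infinity (cyl1 :: ((real ^ 'n) \<times> real) set).
    weighted_mass \<alpha> (2 * real k) f \<le> C * weighted_energy \<alpha> f powr (2 * real k / 2)"
    by simp
  then show ?thesis using k(2) C(1) by blast
qed

lemma powr_le_sum_of_powrs:
  fixes t :: real
  assumes "0 \<le> t" "p \<le> q" "q \<le> r"
  shows "t powr q \<le> t powr p + t powr r"
proof (cases "t \<le> 1")
  case True
  then have "t powr q \<le> t powr p" using assms by (intro powr_mono') auto
  then show ?thesis by (simp add: add_increasing2)
next
  case False
  then have "t powr q \<le> t powr r" using assms by (intro powr_mono) auto
  then show ?thesis by (simp add: add_increasing)
qed

text \<open>If \<open>K\<close> is of degree two in \<open>f\<close>, both sides are homogeneous of degree \<open>Q\<close>, so \<open>powr_le_sum_of_powrs\<close> is applied to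
  \<open>t = \<bar>f\<bar> / sqrt K\<close>. For \<open>K = 0\<close> this scaling is meaningless, but then it suffices to take \<open>t = \<bar>f\<bar>\<close> as both
  bounding terms are at most zero.\<close>

lemma weighted_mass_interpolation:
  fixes f :: "(real ^ 'n) \<times> real \<Rightarrow> real"
  assumes f: "f \<in> C0_infinity cyl1" and Q: "2 \<le> Q" "Q \<le> P"
    and K: "0 \<le> K" and m2: "weighted_mass \<alpha> 2 f \<le> A * K" and mP: "weighted_mass \<alpha> P f \<le> C * K powr (P / 2)"
  shows "weighted_mass \<alpha> Q f \<le> (A + C) * K powr (Q / 2)"
proof -
  let ?w = "\<lambda>p z. (1 - \<bar>snd z\<bar>) powr \<alpha> * \<bar>f z\<bar> powr p"
  have int: "integrable lborel (?w p)" if "p > 0" for p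
    using integrable_weighted_mass[OF f that] .
  show ?thesis
  proof (cases "K = 0")
    case True
    have "weighted_mass \<alpha> Q f \<le> (\<integral>z. ?w 2 z + ?w P z \<partial>lborel)"
      unfolding weighted_mass_def
    proof (rule integral_mono')
      show "integrable lborel (\<lambda>z. ?w 2 z + ?w P z)"
        using Q by (intro Bochner_Integration.integrable_add int) auto
      show "?w Q z \<le> ?w 2 z + ?w P z" for z
        using mult_left_mono[OF powr_le_sum_of_powrs[of "\<bar>f z\<bar>" 2 Q P], of "(1 - \<bar>snd z\<bar>) powr \<alpha>"] Q
        by (simp only: distrib_left) simp
    qed simp
    also have "\<dots> = weighted_mass \<alpha> 2 f + weighted_mass \<alpha> P f"
      using Q unfolding weighted_mass_def by (intro Bochner_Integration.integral_add int) auto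
    also have "\<dots> \<le> 0" using m2 mP True by simp
    finally show ?thesis using True by simp
  next
    case False
    then have K: "K > 0" using K by simp
    define h where "h p = K powr (Q / 2) * K powr (- (p / 2))" for p
    have "weighted_mass \<alpha> Q f \<le> (\<integral>z. h 2 * ?w 2 z + h P * ?w P z \<partial>lborel)"
      unfolding weighted_mass_def
    proof (rule integral_mono')
      show "integrable lborel (\<lambda>z. h 2 * ?w 2 z + h P * ?w P z)"
        using Q by (intro Bochner_Integration.integrable_add integrable_mult_right int) auto
      fix z
      define t where "t = \<bar>f z\<bar> * K powr (- 1 / 2)"
      have t: "t powr p = \<bar>f z\<bar> powr p * K powr (- (p / 2))" for p
        by (simp add: t_def powr_mult powr_powr)
      have "t powr Q \<le> t powr 2 + t powr P"
        using Q by (intro powr_le_sum_of_powrs) (simp_all add: t_def)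
      then have "((1 - \<bar>snd z\<bar>) powr \<alpha> * K powr (Q / 2)) * t powr Q \<le> ((1 - \<bar>snd z\<bar>) powr \<alpha> * K powr (Q / 2)) * (t powr 2 + t powr P)"
        by (intro mult_left_mono) simp_all
      moreover have "((1 - \<bar>snd z\<bar>) powr \<alpha> * K powr (Q / 2)) * t powr Q = ?w Q z"
      proof -
        have "K powr (Q / 2) * K powr (- (Q / 2)) = 1"
          using K by (simp add: powr_add[symmetric])
        then show ?thesis unfolding t by (simp add: mult_ac)
      qed
      ultimately show "?w Q z \<le> h 2 * ?w 2 z + h P * ?w P z"
        unfolding t h_def by (simp only: distrib_left mult_ac)
      show "0 \<le> h 2 * ?w 2 z + h P * ?w P z" by (simp add: h_def)
    qed
    also have "\<dots> = h 2 * weighted_mass \<alpha> 2 f + h P * weighted_mass \<alpha> P f"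
    proof -
      have "(\<integral>z. h 2 * ?w 2 z + h P * ?w P z \<partial>lborel) = (\<integral>z. h 2 * ?w 2 z \<partial>lborel) + (\<integral>z. h P * ?w P z \<partial>lborel)"
        by (intro Bochner_Integration.integral_add integrable_mult_right int) (use Q in auto)
      then show ?thesis
        unfolding weighted_mass_def by (simp only: integral_mult_right_zero)
    qed
    also have "\<dots> \<le> h 2 * (A * K) + h P * (C * K powr (P / 2))"
      using m2 mP by (intro add_mono mult_left_mono) (auto simp: h_def)
    also have "\<dots> = (A + C) * K powr (Q / 2)"
      using K by (simp add: h_def powr_minus field_simps)
    finally show ?thesis .
  qed
qed

text \<open>Outside the cylinder the integrands vanish, so the integrals over the cylinder are integrals over the
  whole space.\<close>

lemma set_integral_eq_weighted_mass:
  fixes f :: "(real ^ 'n) \<times> real \<Rightarrow> real"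
  assumes "f \<in> C0_infinity cyl1"
  shows "(LINT (x, l):cyl1|lborel. (1 - \<bar>l\<bar>) powr \<alpha> * \<bar>f (x, l)\<bar> powr Q) = weighted_mass \<alpha> Q f"
  unfolding set_lebesgue_integral_def weighted_mass_def
proof (rule Bochner_Integration.integral_cong[OF refl])
  fix z :: "(real ^ 'n) \<times> real"
  show "indicat_real cyl1 z *\<^sub>R (case z of (x, l) \<Rightarrow> (1 - \<bar>l\<bar>) powr \<alpha> * \<bar>f (x, l)\<bar> powr Q)
      = (1 - \<bar>snd z\<bar>) powr \<alpha> * \<bar>f z\<bar> powr Q"
    using C0_infinity_eq_0[OF assms, of z] by (cases z) (auto simp: indicator_def)
qed

lemma set_integral_eq_weighted_energy:
  fixes f :: "(real ^ 'n) \<times> real \<Rightarrow> real"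
  assumes f: "f \<in> C0_infinity cyl1"
  shows "(LINT (x, l):cyl1|lborel. (1 - \<bar>l\<bar>) powr \<alpha> *
     ((norm (grad_x f (x, l)))\<^sup>2 + (1 - \<bar>l\<bar>)\<^sup>2 * \<bar>partial_l f (x, l)\<bar>\<^sup>2)) = weighted_energy \<alpha> f"
  unfolding set_lebesgue_integral_def weighted_energy_def
proof (rule Bochner_Integration.integral_cong[OF refl])
  fix z :: "(real ^ 'n) \<times> real"
  have "weighted_grad_norm f z = 0" if "z \<notin> cyl1"
  proof (rule weighted_grad_norm_props(4)[OF f])
    show "frechet_derivative f (at z) = (\<lambda>_. 0)"
      using C0_infinity_props(4)[OF f] that by blast
  qed
  moreover have "(weighted_grad_norm f z)\<^sup>2 = (norm (grad_x f z))\<^sup>2 + (1 - \<bar>snd z\<bar>)\<^sup>2 * \<bar>partial_l f z\<bar>\<^sup>2"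
    unfolding weighted_grad_norm_def by simp
  ultimately show "indicat_real cyl1 z *\<^sub>R (case z of (x, l) \<Rightarrow> (1 - \<bar>l\<bar>) powr \<alpha> *
     ((norm (grad_x f (x, l)))\<^sup>2 + (1 - \<bar>l\<bar>)\<^sup>2 * \<bar>partial_l f (x, l)\<bar>\<^sup>2))
      = (1 - \<bar>snd z\<bar>) powr \<alpha> * (weighted_grad_norm f z)\<^sup>2"
    by (cases "z \<in> cyl1") (auto simp: case_prod_beta')
qed

theorem theorem1p2:
  fixes N :: nat and \<alpha> Q :: real
  assumes "N \<ge> 2"
    and "CARD('n::finite) = N - 1"
    and "\<alpha> < -1"
    and "Q \<ge> 2"
    and "N \<ge> 3 \<Longrightarrow> Q \<le> 2 * real N / (real N - 2)"
  shows "\<exists>C>0. \<forall>f \<in> C0_infinity (cyl1 :: ((real ^ 'n) \<times> real) set).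
           (LINT (x, l):cyl1|lborel. (1 - \<bar>l\<bar>) powr \<alpha> * \<bar>f (x, l)\<bar> powr Q) powr (2 / Q)
           \<le> C * (LINT (x, l):cyl1|lborel. (1 - \<bar>l\<bar>) powr \<alpha> *
                    ((norm (grad_x f (x, l)))\<^sup>2 + (1 - \<bar>l\<bar>)\<^sup>2 * \<bar>partial_l f (x, l)\<bar>\<^sup>2))"
proof -
  have N: "real N = real CARD('n) + 1" "CARD('n) \<ge> 2 \<Longrightarrow> N \<ge> 3"
    using assms(1,2) by auto
  have "Q \<le> 2 * (real CARD('n) + 1) / (real CARD('n) - 1)" if "CARD('n) \<ge> 2"
    using assms(5)[OF N(2)[OF that]] by (simp add: N(1))
  then obtain P C where P: "Q \<le> P" "0 \<le> C" and C: "\<And>f :: (real ^ 'n) \<times> real \<Rightarrow> real. f \<in> C0_infinity cyl1 \<Longrightarrow>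
    weighted_mass \<alpha> P f \<le> C * weighted_energy \<alpha> f powr (P / 2)"
    using weighted_sobolev_large_exponent[where 'n='n, of \<alpha> Q] assms(3,4) by auto
  have "weighted_mass \<alpha> Q f powr (2 / Q) \<le> (16 + C) powr (2 / Q) * weighted_energy \<alpha> f"
    if f: "f \<in> C0_infinity cyl1" for f :: "(real ^ 'n) \<times> real \<Rightarrow> real"
  proof -
    have "weighted_mass \<alpha> Q f powr (2 / Q) \<le> ((16 + C) * weighted_energy \<alpha> f powr (Q / 2)) powr (2 / Q)"
      using assms(4) weighted_mass_nonneg
        weighted_mass_interpolation[OF f assms(4) P(1) weighted_energy_nonneg weighted_poincare[OF f] C[OF f]]
      by (intro powr_mono2) auto
    also have "\<dots> = (16 + C) powr (2 / Q) * weighted_energy \<alpha> f"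
      using assms(4) P(2) weighted_energy_nonneg[of \<alpha> f] by (simp add: powr_mult powr_powr)
    finally show ?thesis .
  qed
  moreover have "0 < (16 + C) powr (2 / Q)" using P(2) by simp
  ultimately show ?thesis
    by (intro exI[of _ "(16 + C) powr (2 / Q)"] conjI ballI)
      (simp_all only: set_integral_eq_weighted_mass set_integral_eq_weighted_energy)
qed

end
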